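(* Suppose $t\ge4$. (i) If $d_{\mathrm{plan}}$ is a Class A type $\mathcal W_1$ UBRMD with $t$ treatments and $gt$ subjects, then for the minimal design $d_{\min}$ that consists of the first $t-1$ periods of $d_{\mathrm{plan}}$, the eigenvalues (with multiplicity) of the direct-effects information matrix $C_D^{d_{\min}}$ are $g\theta_0=0$ and $g\theta_r$, where $$\theta_r=\frac{t}{t-1}\left[t-2-\frac{2t\left(1+\cos\frac{2\pi r}{t}\right)}{t(t-3)-2\cos\frac{2\pi r}{t}}\right],\qquad r=1,\dots,t-1.$$ (ii) If $d_{\mathrm{plan}}$ is a Class B type $\mathcal W_1$ UBRMD with $t$ treatments and $gt$ subjects, then for the design $d_{\min}$ that consists of the first $t-1$ periods of $d_{\mathrm{plan}}$, the eigenvalues (with multiplicity) of $C_D^{d_{\min}}$ are $g\theta_0=0$ and $g\theta_r$, where $$\theta_r=\frac{t}{t-1}\left[t-2-\frac{t\left(1+\cos\frac{2\pi r}{t}\right)^2}{t(t-3)-2\cos\frac{2\pi r}{t}}\right],\qquad r=1,\dots,t-1.$$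
   Context: A (crossover) design with $p$ periods, $s$ subjects and $t$ treatments labelled $0,\dots,t-1$ assigns a treatment $d(k,i)$ to each subject $i\in\{1,\dots,s\}$ in each period $k\in\{1,\dots,p\}$; it is viewed as a $p\times s$ array (rows = periods, columns = treatment sequences). It is uniform if each subject receives every treatment in the same number of periods and in each period every treatment is given to the same number of subjects. It is balanced if, in the order of application, each treatment is immediately preceded by every other treatment the same number of times and is never immediately preceded by itself. A UBRMD with $t$ treatments, $t$ periods and $s=gt$ subjects ($g$ a positive integer) is a uniform and balanced such design. For a $t\times t$ array $W$ of treatments, $P_j(W)$ is the $t\times t$ matrix whose $(h,i)$ entry is $1$ if the $(j,i)$ entry of $W$ is $h$, and $0$ otherwise. Class A type $\mathcal W_1$ UBRMD: take a $t\times t$ square $W$ that is a UBRMD, such that $1$ is an eigenvalue of multiplicity one of the permutation matrix $\Pi=P_t(W)P_{t-1}(W)'$; the design $d_{\mathrm{plan}}$ assigns $g$ subjects to each sequence (column) of $W$. Class B type $\mathcal W_1$ UBRMD: ($g$ even) take two $t\times t$ squares $W_1,W_2$ such that the $t\times 2t$ array $(W_1\ W_2)$ is a UBRMD and each treatment appears exactly once in each of the rows $t-1$ and $t$ of each $W_\delta$. Put $\Pi_\delta=P_t(W_\delta)P_{t-1}(W_\delta)'$, $\delta=1,2$ (permutation matrices). Suppose $1$ is an eigenvalue of $\Pi_\delta$ of multiplicity one for $\delta=1,2$, and $\Pi_2=\Pi_1'$. The design $d_{\mathrm{plan}}$ assigns $g/2$ subjects to each sequence (column) of $(W_1\ W_2)$.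 Model: $Y=X_S\beta+X_P\alpha+X_D\tau+X_C\rho+\epsilon$, with fixed subject, period, direct treatment and carry-over effects. With rows indexed by (subject $i$, period $k$): $X_S=I_s\otimes\mathbf 1_p$, $X_P=\mathbf 1_s\otimes I_p$; the row of $X_D$ for $(i,k)$ has a $1$ in the column of treatment $d(k,i)$ and $0$ elsewhere; the row of $X_C$ for $(i,k)$ has a $1$ in the column of treatment $d(k-1,i)$ and $0$ elsewhere if $k\ge2$, and is zero if $k=1$. Put $N_{ab}=X_a'X_b$ for $a,b\in\{S,P,D,C\}$, $r_D=N_{DS}\mathbf 1_s$, $r_C=N_{CS}\mathbf 1_s$, $r_D^\delta=\mathrm{diag}(r_D)$, $r_C^\delta=\mathrm{diag}(r_C)$, and $C_{11}=r_D^\delta+\frac1{ps}r_Dr_D'-\frac1pN_{DS}N_{SD}-\frac1sN_{DP}N_{PD}$, $C_{22}=r_C^\delta+\frac1{ps}r_Cr_C'-\frac1pN_{CS}N_{SC}-\frac1sN_{CP}N_{PC}$, $C_{12}=N_{DC}+\frac1{ps}r_Dr_C'-\frac1pN_{DS}N_{SC}-\frac1sN_{DP}N_{PC}$, $C_{21}=C_{12}'$. The direct-effects information matrix of the design $d$ is the $t\times t$ matrix $C_D^d=C_{11}-C_{12}C_{22}^{-}C_{21}$, where $M^-$ is any generalized inverse ($MM^-M=M$). For $d_{\min}$ these are computed with $p=t-1$, $s=gt$. Here $'$ is transpose and $\mathbf 1_a$ is the all-ones vector of length $a$. *)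

theory Defs
  imports Complex_Main "Jordan_Normal_Form.Char_Poly"
begin

(* A design with p periods and s subjects is a p x s matrix of treatments 0, ..., t-1.
   Periods and subjects are numbered from 0, so entry (k, i) is d(k+1, i+1) in the usual
   1-based numbering. *)

definition design :: "nat \<Rightarrow> nat \<Rightarrow> nat \<Rightarrow> nat mat \<Rightarrow> bool" where
  "design t p s D \<longleftrightarrow> D \<in> carrier_mat p s \<and> (\<forall>k<p. \<forall>i<s. D $$ (k, i) < t)"

definition uniform :: "nat \<Rightarrow> nat mat \<Rightarrow> bool" where
  "uniform t D \<longleftrightarrow>
     (\<forall>i<dim_col D. \<forall>a<t. \<forall>b<t.
        card {k. k < dim_row D \<and> D $$ (k, i) = a} = card {k. k < dim_row D \<and> D $$ (k, i) = b}) \<and>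
     (\<forall>k<dim_row D. \<forall>a<t. \<forall>b<t.
        card {i. i < dim_col D \<and> D $$ (k, i) = a} = card {i. i < dim_col D \<and> D $$ (k, i) = b})"

definition preceded_count :: "nat mat \<Rightarrow> nat \<Rightarrow> nat \<Rightarrow> nat" where
  "preceded_count D a b =
     card {(k, i). Suc k < dim_row D \<and> i < dim_col D \<and> D $$ (Suc k, i) = a \<and> D $$ (k, i) = b}"

definition balanced :: "nat \<Rightarrow> nat mat \<Rightarrow> bool" where
  "balanced t D \<longleftrightarrow>
     (\<exists>m. \<forall>a<t. \<forall>b<t. a \<noteq> b \<longrightarrow> preceded_count D a b = m) \<and>
     (\<forall>a<t. preceded_count D a a = 0)"

definition UBRMD :: "nat \<Rightarrow> nat \<Rightarrow> nat mat \<Rightarrow> bool" where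
  "UBRMD t g D \<longleftrightarrow> 0 < g \<and> design t t (g * t) D \<and> uniform t D \<and> balanced t D"

definition treatment_mat :: "nat \<Rightarrow> nat \<Rightarrow> nat mat \<Rightarrow> real mat" where
  "treatment_mat t j W = mat t t (\<lambda>(h, i). if W $$ (j, i) = h then 1 else 0)"

(* P_t(W) P_(t-1)(W)'; the last two rows of W have indices t-1 and t-2. *)
definition transition_mat :: "nat \<Rightarrow> nat mat \<Rightarrow> real mat" where
  "transition_mat t W = treatment_mat t (t - 1) W * transpose_mat (treatment_mat t (t - 2) W)"

(* Algebraic multiplicity; since transition_mat is only used where it is a permutation matrix,
   it coincides there with the geometric multiplicity. *)
definition eigenvalue_multiplicity :: "real mat \<Rightarrow> real \<Rightarrow> nat" where
  "eigenvalue_multiplicity A x = order x (char_poly A)"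

(* c maps every subject to the column of W that is used as its treatment sequence. *)
definition assigns_subjects :: "nat \<Rightarrow> nat mat \<Rightarrow> nat mat \<Rightarrow> bool" where
  "assigns_subjects m W D \<longleftrightarrow>
     dim_row D = dim_row W \<and> dim_col D = m * dim_col W \<and>
     (\<exists>c. (\<forall>i<dim_col D. c i < dim_col W \<and> col D i = col W (c i)) \<and>
          (\<forall>j<dim_col W. card {i. i < dim_col D \<and> c i = j} = m))"

definition class_A :: "nat \<Rightarrow> nat \<Rightarrow> nat mat \<Rightarrow> bool" where
  "class_A t g D \<longleftrightarrow> 0 < g \<and>
     (\<exists>W. W \<in> carrier_mat t t \<and> UBRMD t 1 W \<and>
          eigenvalue_multiplicity (transition_mat t W) 1 = 1 \<and>
          assigns_subjects g W D)"

definition once_in_last_two_rows :: "nat \<Rightarrow> nat mat \<Rightarrow> bool" where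
  "once_in_last_two_rows t W \<longleftrightarrow>
     (\<forall>j\<in>{t - 2, t - 1}. \<forall>a<t. card {i. i < dim_col W \<and> W $$ (j, i) = a} = 1)"

definition class_B :: "nat \<Rightarrow> nat \<Rightarrow> nat mat \<Rightarrow> bool" where
  "class_B t g D \<longleftrightarrow> 0 < g \<and> even g \<and>
     (\<exists>W1 W2. W1 \<in> carrier_mat t t \<and> W2 \<in> carrier_mat t t \<and>
          UBRMD t 2 (mat_of_cols t (cols W1 @ cols W2)) \<and>
          once_in_last_two_rows t W1 \<and> once_in_last_two_rows t W2 \<and>
          eigenvalue_multiplicity (transition_mat t W1) 1 = 1 \<and>
          eigenvalue_multiplicity (transition_mat t W2) 1 = 1 \<and>
          transition_mat t W2 = transpose_mat (transition_mat t W1) \<and>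
          assigns_subjects (g div 2) (mat_of_cols t (cols W1 @ cols W2)) D)"

definition first_periods :: "nat \<Rightarrow> nat mat \<Rightarrow> nat mat" where
  "first_periods p D = mat p (dim_col D) (\<lambda>(k, i). D $$ (k, i))"


definition ones_col :: "nat \<Rightarrow> real mat" where
  "ones_col n = mat n 1 (\<lambda>_. 1)"

definition kronecker :: "real mat \<Rightarrow> real mat \<Rightarrow> real mat" (infixl \<open>\<otimes>\<^sub>K\<close> 70) where
  "A \<otimes>\<^sub>K B = mat (dim_row A * dim_row B) (dim_col A * dim_col B)
     (\<lambda>(i, j). A $$ (i div dim_row B, j div dim_col B) * B $$ (i mod dim_row B, j mod dim_col B))"

(* In all four model matrices the row of (subject i, period k) has index i * p + k. *)

definition X_S :: "nat mat \<Rightarrow> real mat" where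
  "X_S D = 1\<^sub>m (dim_col D) \<otimes>\<^sub>K ones_col (dim_row D)"

definition X_P :: "nat mat \<Rightarrow> real mat" where
  "X_P D = ones_col (dim_col D) \<otimes>\<^sub>K 1\<^sub>m (dim_row D)"

definition X_D :: "nat \<Rightarrow> nat mat \<Rightarrow> real mat" where
  "X_D t D = mat (dim_col D * dim_row D) t
     (\<lambda>(r, h). let i = r div dim_row D; k = r mod dim_row D in
        if D $$ (k, i) = h then 1 else 0)"

definition X_C :: "nat \<Rightarrow> nat mat \<Rightarrow> real mat" where
  "X_C t D = mat (dim_col D * dim_row D) t
     (\<lambda>(r, h). let i = r div dim_row D; k = r mod dim_row D in
        if 0 < k \<and> D $$ (k - 1, i) = h then 1 else 0)"

definition cross :: "real mat \<Rightarrow> real mat \<Rightarrow> real mat" where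
  "cross X Y = transpose_mat X * Y"

definition diag_of_col :: "real mat \<Rightarrow> real mat" where
  "diag_of_col r = mat_diag (dim_row r) (\<lambda>i. r $$ (i, 0))"

(* N_DS 1_s and N_CS 1_s, as t x 1 matrices *)
definition r_D :: "nat \<Rightarrow> nat mat \<Rightarrow> real mat" where
  "r_D t D = cross (X_D t D) (X_S D) * ones_col (dim_col D)"

definition r_C :: "nat \<Rightarrow> nat mat \<Rightarrow> real mat" where
  "r_C t D = cross (X_C t D) (X_S D) * ones_col (dim_col D)"

definition C11 :: "nat \<Rightarrow> nat mat \<Rightarrow> real mat" where
  "C11 t D = (let p = real (dim_row D); s = real (dim_col D) in
     diag_of_col (r_D t D)
     + (1 / (p * s)) \<cdot>\<^sub>m (r_D t D * transpose_mat (r_D t D))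
     - (1 / p) \<cdot>\<^sub>m (cross (X_D t D) (X_S D) * cross (X_S D) (X_D t D))
     - (1 / s) \<cdot>\<^sub>m (cross (X_D t D) (X_P D) * cross (X_P D) (X_D t D)))"

definition C22 :: "nat \<Rightarrow> nat mat \<Rightarrow> real mat" where
  "C22 t D = (let p = real (dim_row D); s = real (dim_col D) in
     diag_of_col (r_C t D)
     + (1 / (p * s)) \<cdot>\<^sub>m (r_C t D * transpose_mat (r_C t D))
     - (1 / p) \<cdot>\<^sub>m (cross (X_C t D) (X_S D) * cross (X_S D) (X_C t D))
     - (1 / s) \<cdot>\<^sub>m (cross (X_C t D) (X_P D) * cross (X_P D) (X_C t D)))"

definition C12 :: "nat \<Rightarrow> nat mat \<Rightarrow> real mat" where
  "C12 t D = (let p = real (dim_row D); s = real (dim_col D) in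
     cross (X_D t D) (X_C t D)
     + (1 / (p * s)) \<cdot>\<^sub>m (r_D t D * transpose_mat (r_C t D))
     - (1 / p) \<cdot>\<^sub>m (cross (X_D t D) (X_S D) * cross (X_S D) (X_C t D))
     - (1 / s) \<cdot>\<^sub>m (cross (X_D t D) (X_P D) * cross (X_P D) (X_C t D)))"

definition generalized_inverse :: "real mat \<Rightarrow> real mat \<Rightarrow> bool" where
  "generalized_inverse M G \<longleftrightarrow> G \<in> carrier_mat (dim_col M) (dim_row M) \<and> M * G * M = M"

(* C_D = C11 - C12 G C21, where G stands for the chosen generalized inverse of C22. *)
definition direct_info_mat :: "nat \<Rightarrow> nat mat \<Rightarrow> real mat \<Rightarrow> real mat" where
  "direct_info_mat t D G = C11 t D - C12 t D * G * transpose_mat (C12 t D)"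

(* The list es contains all eigenvalues of A, each repeated according to its multiplicity. *)
definition has_eigenvalues :: "real mat \<Rightarrow> real list \<Rightarrow> bool" where
  "has_eigenvalues A es \<longleftrightarrow> char_poly A = (\<Prod>e\<leftarrow>es. [:- e, 1:])"

definition theta_A :: "nat \<Rightarrow> nat \<Rightarrow> real" where
  "theta_A t r = (if r = 0 then 0 else
     real t / (real t - 1) *
       (real t - 2 - 2 * real t * (1 + cos (2 * pi * real r / real t)) /
          (real t * (real t - 3) - 2 * cos (2 * pi * real r / real t))))"

definition theta_B :: "nat \<Rightarrow> nat \<Rightarrow> real" where
  "theta_B t r = (if r = 0 then 0 else
     real t / (real t - 1) *
       (real t - 2 - real t * (1 + cos (2 * pi * real r / real t)) ^ 2 /
          (real t * (real t - 3) - 2 * cos (2 * pi * real r / real t))))"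

end

theory Submission
  imports Defs "HOL-Combinatorics.Orbits"
begin

text \<open>
  Let \<open>M\<close> be the matrix whose \<open>(a, b)\<close> entry counts the subjects of the full design that receive
  \<open>b\<close> and then \<open>a\<close> in the last two periods. Uniformity and balance determine all the incidence
  matrices of the truncated design up to \<open>M\<close>, which gives
  \<open>C11 = gt(t-2)/(t-1) (I - J/t)\<close>, \<open>C12 = 2g/(t-1) J - t/(t-1) (gI + M)\<close> and
  \<open>C22 = (gt(t-3) I - (M + M') - g(t^2-3t-2)/t J)/(t-1)\<close>.
  In class A, \<open>M = g \<Pi>\<close>; in class B, \<open>M = g/2 (\<Pi> + \<Pi>')\<close>. Since 1 is a simple eigenvalue of the
  permutation matrix \<open>\<Pi>\<close>, the permutation is a \<open>t\<close>-cycle, so the Fourier basis along this cycle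
  diagonalizes \<open>I\<close>, \<open>J\<close>, \<open>\<Pi>\<close> and \<open>\<Pi>'\<close>, hence all the blocks, simultaneously. As \<open>C12\<close> and its transpose
  factor through \<open>C22\<close>, the choice of the generalized inverse is irrelevant and the eigenvalues
  can be read off.
\<close>

section \<open>Permutation matrices with simple eigenvalue one\<close>

text \<open>Each row from \<open>S\<close> is added to row \<open>k\<close> by one elementary
  operation, which preserves the determinant. Since \<open>k\<close> is not in \<open>S\<close>, the
  rows being added never change on the way.\<close>

lemma det_row_add_sum:
  fixes B :: "'a :: comm_ring_1 mat"
  assumes "B \<in> carrier_mat n n" "k < n" "finite S" "S \<subseteq> {..<n}" "k \<notin> S"
  shows "det (mat n n (\<lambda>(i, j). if i = k then B $$ (k, j) + (\<Sum>l\<in>S. B $$ (l, j)) else B $$ (i, j))) = det B"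
  using assms(3-5)
proof (induction S rule: finite_induct)
  case empty
  have "mat n n (\<lambda>(i, j). if i = k then B $$ (k, j) + (\<Sum>l\<in>{}. B $$ (l, j)) else B $$ (i, j)) = B"
    using assms(1) by (intro eq_matI) auto
  then show ?case by simp
next
  case (insert l S)
  let ?C = "mat n n (\<lambda>(i, j). if i = k then B $$ (k, j) + (\<Sum>l\<in>S. B $$ (l, j)) else B $$ (i, j))"
  have l: "l < n" "k \<noteq> l" using insert.prems by auto
  have "mat n n (\<lambda>(i, j). if i = k then B $$ (k, j) + (\<Sum>l\<in>insert l S. B $$ (l, j)) else B $$ (i, j))
      = addrow 1 k l ?C"
    using insert.hyps l by (intro eq_matI) (auto simp: algebra_simps)
  then have "det (mat n n (\<lambda>(i, j). if i = k then B $$ (k, j) + (\<Sum>l\<in>insert l S. B $$ (l, j)) else B $$ (i, j)))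
      = det ?C"
    using det_addrow[OF l, of ?C 1] by simp
  then show ?case using insert by auto
qed

text \<open>Adding the other rows of \<open>S\<close> to row \<open>k\<close> turns that row into
  \<open>c\<close> times \<open>v\<close>, and \<open>c\<close> comes out by linearity in row
  \<open>k\<close>. The remaining matrix keeps all other rows of \<open>B\<close>, so the extraction
  can be repeated on a disjoint set of rows.\<close>

lemma det_factor_row_sum:
  fixes B :: "'a :: comm_ring_1 mat"
  assumes B: "B \<in> carrier_mat n n" and S: "S \<subseteq> {..<n}" "k \<in> S"
    and sum: "\<And>j. j < n \<Longrightarrow> (\<Sum>i\<in>S. B $$ (i, j)) = c * v j"
  shows "det B = c * det (mat n n (\<lambda>(i, j). if i = k then v j else B $$ (i, j)))"
proof -
  have fin: "finite S" using S finite_subset by blast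
  have k: "k < n" using S by auto
  have rem: "B $$ (k, j) + (\<Sum>l\<in>S - {k}. B $$ (l, j)) = (\<Sum>i\<in>S. B $$ (i, j))" for j
    by (rule sum.remove[OF fin S(2), symmetric])
  have "mat n n (\<lambda>(i, j). if i = k then B $$ (k, j) + (\<Sum>l\<in>S - {k}. B $$ (l, j)) else B $$ (i, j))
     = multrow k c (mat n n (\<lambda>(i, j). if i = k then v j else B $$ (i, j)))"
    using sum by (intro eq_matI) (auto simp: rem)
  then have "det B = det (multrow k c (mat n n (\<lambda>(i, j). if i = k then v j else B $$ (i, j))))"
    using det_row_add_sum[OF B k finite_Diff[OF fin], of "{k}"] S(1) by (simp add: Diff_subset[THEN subset_trans])
  then show ?thesis using det_multrow[OF k, of "mat n n (\<lambda>(i, j). if i = k then v j else B $$ (i, j))" c]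
    by simp
qed

text \<open>In \<open>xI - A\<close>, adding up the rows of \<open>S\<close> gives \<open>x - 1\<close> times the indicator vector of \<open>S\<close>, and
  likewise for the complement; so \<open>x - 1\<close> can be pulled out of the determinant twice.\<close>

lemma char_poly_double_root_one:
  fixes A :: "real mat"
  assumes A: "A \<in> carrier_mat n n" and S: "S \<subseteq> {..<n}" "S \<noteq> {}" "S \<noteq> {..<n}"
    and sum1: "\<And>j. j < n \<Longrightarrow> (\<Sum>i\<in>S. A $$ (i, j)) = (if j \<in> S then 1 else 0)"
    and sum2: "\<And>j. j < n \<Longrightarrow> (\<Sum>i\<in>{..<n} - S. A $$ (i, j)) = (if j \<in> S then 0 else 1)"
  shows "[:-1, 1:] ^ 2 dvd char_poly A"
proof -
  obtain a where a: "a \<in> S" using S by auto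
  obtain b where b: "b \<in> {..<n} - S" using S by auto
  let ?C = "char_poly_matrix A"
  have C: "?C \<in> carrier_mat n n" using A by simp
  have fin: "finite S" using S finite_subset by blast
  have ind: "?C $$ (i, j) = (if i = j then [:0, 1:] else 0) - [:A $$ (i, j):]" if "i < n" "j < n" for i j
    using A that by (auto simp: char_poly_matrix_def)
  have colsum: "(\<Sum>i\<in>T. ?C $$ (i, j)) = (if j \<in> T then [:0, 1:] else 0) - [:\<Sum>i\<in>T. A $$ (i, j):]"
    if "T \<subseteq> {..<n}" "j < n" for T j
  proof -
    have "finite T" using that finite_subset by blast
    have "(\<Sum>i\<in>T. ?C $$ (i, j)) = (\<Sum>i\<in>T. (if i = j then [:0, 1:] else 0) - [:A $$ (i, j):])"
      using that by (intro sum.cong refl) (rule ind, auto)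
    also have "\<dots> = (if j \<in> T then [:0, 1:] else 0) - (\<Sum>i\<in>T. [:A $$ (i, j):])"
      using \<open>finite T\<close> by (simp add: sum_subtractf)
    also have "(\<Sum>i\<in>T. [:A $$ (i, j):]) = [:\<Sum>i\<in>T. A $$ (i, j):]"
      by (induction T rule: infinite_finite_induct) auto
    finally show ?thesis .
  qed
  let ?v = "\<lambda>j. if j \<in> S then 1 else 0 :: real poly"
  let ?w = "\<lambda>j. if j \<in> S then 0 else 1 :: real poly"
  let ?B = "mat n n (\<lambda>(i, j). if i = a then ?v j else ?C $$ (i, j))"
  have 1: "det ?C = [:-1, 1:] * det ?B"
    using det_factor_row_sum[OF C S(1) a, of "[:-1, 1:]" ?v] colsum[OF S(1)] sum1
    by (auto simp: one_pCons)
  \<comment> \<open>Row \<open>a\<close> lies in \<open>S\<close>, so replacing it does not affect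
    the row sum over the complement, and a second factor can be extracted.\<close>
  have "(\<Sum>i\<in>{..<n} - S. ?B $$ (i, j)) = [:-1, 1:] * ?w j" if "j < n" for j
  proof -
    have "(\<Sum>i\<in>{..<n} - S. ?B $$ (i, j)) = (\<Sum>i\<in>{..<n} - S. ?C $$ (i, j))"
      using a that by (intro sum.cong) auto
    also have "\<dots> = [:-1, 1:] * ?w j"
      using colsum[of "{..<n} - S"] sum2 that by (auto simp: one_pCons)
    finally show ?thesis .
  qed
  then have "det ?B = [:-1, 1:] * det (mat n n (\<lambda>(i, j). if i = b then ?w j else ?B $$ (i, j)))"
    by (intro det_factor_row_sum[where S = "{..<n} - S"]) (use b in auto)
  then have "[:-1, 1:] dvd det ?B" by (rule dvdI)
  then show ?thesis unfolding char_poly_def 1 power2_eq_square by (rule mult_dvd_mono[OF dvd_refl])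
qed

text \<open>A proper orbit would be a nonempty proper invariant set. Both it and its complement then
  contribute a factor x - 1 to the characteristic polynomial, so 1 would be at least a double
  root.\<close>

lemma permutation_mat_single_orbit:
  assumes p: "\<pi> permutes {..<n}" and "0 < n"
    and A: "A = mat n n (\<lambda>(a, b). if a = \<pi> b then 1 else 0)"
    and ord: "eigenvalue_multiplicity A 1 = 1"
  shows "orbit \<pi> 0 = {..<n}"
proof (rule ccontr)
  assume ne: "orbit \<pi> 0 \<noteq> {..<n}"
  let ?S = "orbit \<pi> 0"
  have S: "?S \<subseteq> {..<n}" using p \<open>0 < n\<close> by (intro permutes_orbit_subset) auto
  have finS: "finite ?S" using S finite_subset by blast
  have cyc: "cyclic_on \<pi> ?S" using p by (intro cyclic_on_orbit) auto
  have inS: "\<pi> j \<in> ?S \<longleftrightarrow> j \<in> ?S" for j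
    using cyclic_on_f_in[OF p cyc, of j] cyclic_on_inI[OF cyc, of j] by blast
  have lt: "\<pi> j < n" if "j < n" for j using permutes_in_image[OF p, of j] that by simp
  have "(\<Sum>i\<in>T. A $$ (i, j)) = (if \<pi> j \<in> T then 1 else 0)" if "T \<subseteq> {..<n}" "j < n" for T j
  proof -
    have "finite T" using that finite_subset by blast
    have "(\<Sum>i\<in>T. A $$ (i, j)) = (\<Sum>i\<in>T. if i = \<pi> j then 1 else 0)"
      using that unfolding A by (intro sum.cong) auto
    then show ?thesis using \<open>finite T\<close> by simp
  qed
  then have "[:-1, 1:] ^ 2 dvd char_poly A"
    using S ne inS lt by (intro char_poly_double_root_one[of A n ?S]) (auto simp: A orbit_nonempty)
  moreover have "char_poly A \<noteq> 0"
    using degree_monic_char_poly[of A n] A by auto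
  ultimately have "2 \<le> order 1 (char_poly A)" by (intro order_max) auto
  then show False using ord by (simp add: eigenvalue_multiplicity_def)
qed

section \<open>The Fourier basis along a cycle\<close>

text \<open>The summands are the powers of an \<open>n\<close>-th root of unity, so the geometric
  sum vanishes unless that root is 1. The exponent \<open>m\<close> is an integer because it will be
  a difference of two frequencies.\<close>

lemma sum_cis_roots_of_unity:
  assumes "0 < n"
  shows "(\<Sum>j<n. cis (2 * pi * of_int m * of_nat j / of_nat n)) = (if int n dvd m then of_nat n else 0)"
proof -
  let ?w = "cis (2 * pi * of_int m / of_nat n)"
  have pw: "?w ^ j = cis (2 * pi * of_int m * of_nat j / of_nat n)" for j
    by (simp add: DeMoivre mult_ac)
  have wn: "?w ^ n = 1"
    using assms cis_multiple_2pi[of "of_int m"] by (simp add: pw)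
  have "?w = 1 \<longleftrightarrow> int n dvd m"
  proof
    assume "?w = 1"
    then have "cos (2 * pi * of_int m / of_nat n) = 1" by (metis cis.sel(1) one_complex.sel(1))
    then obtain k :: int where "2 * pi * of_int m / of_nat n = of_int k * 2 * pi"
      unfolding cos_one_2pi_int by auto
    then have "real_of_int m = real_of_int (k * int n)" using assms by (simp add: field_simps)
    then have "m = k * int n" by (simp only: of_int_eq_iff)
    then show "int n dvd m" by simp
  next
    assume "int n dvd m"
    then obtain k where "m = int n * k" by auto
    then have "2 * pi * of_int m / of_nat n = 2 * pi * of_int k" using assms by simp
    then show "?w = 1" by (simp only: cis_multiple_2pi Ints_of_int)
  qed
  moreover have "(\<Sum>j<n. ?w ^ j) = 0" if "?w \<noteq> 1"
    using sum_gp_strict[of ?w n] that wn by simp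
  ultimately show ?thesis by (auto simp flip: pw)
qed

text \<open>Numbering the cycle as 0, \<open>\<pi> 0\<close>, \<open>\<pi> (\<pi> 0)\<close>, ...
  turns \<open>\<pi>\<close> into a cyclic shift, and \<open>f r\<close> is the \<open>r\<close>-th
  Fourier character in this numbering. The negative exponent gives the permutation matrix of
  \<open>\<pi>\<close> the eigenvalue \<open>cis (2 * pi * r / n)\<close>, and its transpose the
  conjugate.\<close>

lemma single_orbit_eigenvectors:
  assumes p: "\<pi> permutes {..<n}" and n: "0 < n" and orb: "orbit \<pi> 0 = {..<n}"
  obtains f :: "nat \<Rightarrow> nat \<Rightarrow> complex" where
    "\<And>r a. a < n \<Longrightarrow> f r a = cis (2 * pi * of_nat r / of_nat n) * f r (\<pi> a)"
    "\<And>r r'. r < n \<Longrightarrow> r' < n \<Longrightarrow> (\<Sum>a<n. cnj (f r a) * f r' a) = (if r = r' then of_nat n else 0)"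
    "\<And>a. f 0 a = 1"
proof -
  define z where "z = (\<lambda>j. (\<pi> ^^ j) 0)"
  have self: "0 \<in> orbit \<pi> 0" using orb n by simp
  have inj': "inj_on z {0..<funpow_dist1 \<pi> 0 0}" using inj_on_funpow_dist1[OF self] by (simp add: z_def)
  have im': "{..<n} = z ` {0..<funpow_dist1 \<pi> 0 0}" using orbit_conv_funpow_dist1[OF self] orb by (simp add: z_def)
  \<comment> \<open>The first return time to 0 is the size of the orbit.\<close>
  have len: "funpow_dist1 \<pi> 0 0 = n" using card_image[OF inj'] im' by (metis card_atLeastLessThan card_lessThan diff_zero)
  have inj: "inj_on z {..<n}" using inj' unfolding len atLeast0LessThan .
  have im: "z ` {..<n} = {..<n}" using im' unfolding len atLeast0LessThan by simp
  have zn: "z n = z 0" using funpow_dist1_prop[OF self] unfolding len by (simp add: z_def)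
  have zS: "z (Suc j) = \<pi> (z j)" for j by (simp add: z_def)
  define s where "s = inv_into {..<n} z"
  have sz: "s (z j) = j" if "j < n" for j using inj that by (simp add: s_def inv_into_f_f)
  define f where "f = (\<lambda>r a. cis (- (2 * pi * of_nat r * of_nat (s a) / of_nat n)))"
  \<comment> \<open>The case \<open>j = n\<close> is the wrap-around from the last point of the
    cycle to the first; the phase has then made \<open>r\<close> full turns.\<close>
  have fz: "f r (z j) = cis (- (2 * pi * of_nat r * of_nat j / of_nat n))" if "j \<le> n" for r j
  proof (cases "j = n")
    case True
    have "cis (- (2 * pi * of_nat r)) = 1" using cis_multiple_2pi[of "- of_nat r"] by simp
    then show ?thesis using True n by (simp add: zn f_def sz)
  qed (use that sz in \<open>simp add: f_def\<close>)
  show ?thesis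
  proof
    fix r a assume "a < n"
    then obtain j where j: "j < n" "a = z j" using im by (metis imageE lessThan_iff)
    show "f r a = cis (2 * pi * of_nat r / of_nat n) * f r (\<pi> a)"
      using j n by (simp add: fz cis_mult flip: zS) (simp add: field_simps)
  next
    fix r r' assume r: "r < n" "r' < n"
    have "(\<Sum>a<n. cnj (f r a) * f r' a) = (\<Sum>j<n. cnj (f r (z j)) * f r' (z j))"
      using sum.reindex[OF inj, of "\<lambda>a. cnj (f r a) * f r' a"] im by simp
    also have "\<dots> = (\<Sum>j<n. cis (2 * pi * of_int (int r - int r') * of_nat j / of_nat n))"
      by (intro sum.cong refl) (simp add: fz cis_cnj cis_mult algebra_simps diff_divide_distrib)
    also have "\<dots> = (if int n dvd int r - int r' then of_nat n else 0)"
      by (rule sum_cis_roots_of_unity[OF n])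
    also have "int n dvd int r - int r' \<longleftrightarrow> r = r'"
      using r by (simp flip: mod_eq_dvd_iff)
    finally show "(\<Sum>a<n. cnj (f r a) * f r' a) = (if r = r' then of_nat n else 0)" .
  next
    show "f 0 a = 1" for a by (simp add: f_def)
  qed
qed

section \<open>Simultaneous diagonalization of a Schur complement\<close>

lemma dim_mat_diag [simp]: "dim_row (mat_diag n l) = n" "dim_col (mat_diag n l) = n"
  by (simp_all add: mat_diag_def)

lemma char_poly_diagonalized:
  fixes A :: "'a :: comm_ring_1 mat"
  assumes "A \<in> carrier_mat n n" "F \<in> carrier_mat n n" "F' \<in> carrier_mat n n"
    and inv: "F * F' = 1\<^sub>m n" "F' * F = 1\<^sub>m n" and AF: "A * F = F * mat_diag n l"
  shows "char_poly A = (\<Prod>r\<leftarrow>[0..<n]. [:- l r, 1:])"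
proof -
  have "A = A * (F * F')" using assms(1) inv by simp
  also have "\<dots> = F * mat_diag n l * F'" using assms(1-3) AF by (simp flip: assoc_mult_mat)
  finally have "similar_mat A (mat_diag n l)"
    using assms by (intro similar_matI[of _ _ F F' n]) auto
  then have "char_poly A = char_poly (mat_diag n l)" by (rule char_poly_similar)
  also have "\<dots> = (\<Prod>a\<leftarrow>diag_mat (mat_diag n l). [:- a, 1:])"
    by (rule char_poly_upper_triangular[of _ n]) (auto simp: mat_diag_def upper_triangular_def)
  also have "diag_mat (mat_diag n l) = map l [0..<n]"
    by (auto simp: diag_mat_def mat_diag_def)
  finally show ?thesis by (simp add: o_def)
qed

text \<open>The Fourier eigenvectors are complex while the information matrix is real. The
  factorization found over the complex numbers descends because the embedding of real polynomials is
  injective.\<close>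

lemma of_real_char_poly_eqI:
  assumes "A \<in> carrier_mat n n"
    and "char_poly (map_mat complex_of_real A) = (\<Prod>e\<leftarrow>es. [:- complex_of_real e, 1:])"
  shows "char_poly A = (\<Prod>e\<leftarrow>es. [:- e, 1:])"
proof -
  interpret map_poly_inj_idom_hom complex_of_real ..
  have "map_poly complex_of_real (char_poly A) = (\<Prod>e\<leftarrow>es. [:- complex_of_real e, 1:])"
    using of_real_hom.char_poly_hom[OF assms(1), where ?'a = complex] assms(2) by simp
  also have "\<dots> = map_poly complex_of_real (\<Prod>e\<leftarrow>es. [:- e, 1:])"
    by (induction es) (simp_all add: hom_distribs)
  finally show ?thesis by simp
qed

text \<open>Where \<open>h r = 0\<close>, also \<open>b r = c r = 0\<close>, and the quotient is the right value because \<open>x / 0 = 0\<close>.\<close>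

lemma schur_complement_diagonalized:
  fixes A B C H G :: "'a :: field mat"
  assumes carr: "A \<in> carrier_mat n n" "B \<in> carrier_mat n n" "C \<in> carrier_mat n n" "H \<in> carrier_mat n n"
      "G \<in> carrier_mat n n" "F \<in> carrier_mat n n" "F' \<in> carrier_mat n n"
    and inv: "F * F' = 1\<^sub>m n"
    and diag: "A * F = F * mat_diag n a" "B * F = F * mat_diag n b"
      "C * F = F * mat_diag n c" "H * F = F * mat_diag n h"
    and zero: "\<And>r. r < n \<Longrightarrow> h r = 0 \<Longrightarrow> b r = 0 \<and> c r = 0"
    and G: "H * G * H = H"
  shows "(A - B * G * C) * F = F * mat_diag n (\<lambda>r. a r - b r * c r / h r)"
proof -
  note assoc = assoc_mult_mat[where ?n\<^sub>1 = n and ?n\<^sub>2 = n and ?n\<^sub>3 = n and ?n\<^sub>4 = n]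
  have dd: "mat_diag n (\<lambda>r. x r / h r * h r) = mat_diag n x"
    if "\<And>r. r < n \<Longrightarrow> h r = 0 \<Longrightarrow> x r = 0" for x
    using that by (intro eq_matI) (auto simp: mat_diag_def)
  \<comment> \<open>These are the witnesses that factor the outer blocks through \<open>H\<close>:
    it will turn out that \<open>B = ?E * H\<close> and \<open>C * F = H * F * ?Q\<close>.\<close>
  let ?E = "F * mat_diag n (\<lambda>r. b r / h r) * F'" and ?Q = "mat_diag n (\<lambda>r. c r / h r)"
  have EC: "?E \<in> carrier_mat n n" using carr by (intro mult_carrier_mat[of _ n n]) auto
  have CF: "C * F = H * F * ?Q"
  proof -
    have "H * F * ?Q = F * (mat_diag n h * ?Q)" unfolding diag using carr by (simp add: assoc)
    also have "mat_diag n h * ?Q = mat_diag n c" using dd[of c] zero by (simp add: mult.commute)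
    finally show ?thesis using diag by simp
  qed
  have "B * F = ?E * H * F"
  proof -
    have F'F: "F' * F = 1\<^sub>m n" using mat_mult_left_right_inverse[OF _ _ inv] carr by simp
    have "?E * H * F = F * mat_diag n (\<lambda>r. b r / h r) * (F' * (H * F))"
      using carr by (simp add: assoc mult_carrier_mat[of _ n n _ n])
    also have "F' * (H * F) = F' * F * mat_diag n h" unfolding diag using carr by (simp add: assoc)
    also have "\<dots> = mat_diag n h" unfolding F'F by simp
    also have "F * mat_diag n (\<lambda>r. b r / h r) * mat_diag n h = F * mat_diag n b"
      using dd[of b] zero carr by (simp add: assoc)
    finally show ?thesis using diag by simp
  qed
  then have "B * F * F' = ?E * H * F * F'" by simp
  then have B: "B = ?E * H" using carr EC inv by (simp add: assoc)
  have "B * G * C * F = B * G * (H * F * ?Q)" using carr CF by (simp add: assoc)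
  \<comment> \<open>Now \<open>G\<close> occurs only inside \<open>H * G * H\<close>, which equals
    \<open>H\<close> for every generalized inverse.\<close>
  also have "\<dots> = ?E * (H * G * H) * (F * ?Q)" unfolding B using carr EC by (simp add: assoc)
  also have "\<dots> = B * F * ?Q" unfolding G B using carr EC by (simp add: assoc)
  also have "\<dots> = F * mat_diag n (\<lambda>r. b r * c r / h r)" unfolding diag using carr by (simp add: assoc)
  finally have 1: "B * G * C * F = F * mat_diag n (\<lambda>r. b r * c r / h r)" .
  have "(A - B * G * C) * F = A * F - B * G * C * F"
    using carr by (intro minus_mult_distrib_mat) auto
  also have "\<dots> = F * mat_diag n (\<lambda>r. a r - b r * c r / h r)"
    unfolding 1 diag using carr by (intro eq_matI) (auto simp: mat_diag_mult_right[of _ n n] algebra_simps)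
  finally show ?thesis .
qed

text \<open>Entrywise form for real blocks with a common orthogonal family of complex eigenvectors.
  \<open>B\<close> and its transpose get separate eigenvalues \<open>b\<close> and \<open>c\<close>,
  since \<open>B\<close> need not be symmetric.\<close>

lemma schur_complement_eigenvalues:
  fixes A B H G :: "real mat" and f :: "nat \<Rightarrow> nat \<Rightarrow> complex"
  assumes carr: "A \<in> carrier_mat n n" "B \<in> carrier_mat n n" "H \<in> carrier_mat n n" "G \<in> carrier_mat n n"
    and G: "H * G * H = H" and n: "0 < n"
    and orth: "\<And>r r'. r < n \<Longrightarrow> r' < n \<Longrightarrow> (\<Sum>a<n. cnj (f r a) * f r' a) = (if r = r' then of_nat n else 0)"
    and A: "\<And>r x. r < n \<Longrightarrow> x < n \<Longrightarrow> (\<Sum>y<n. of_real (A $$ (x, y)) * f r y) = a r * f r x"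
    and B: "\<And>r x. r < n \<Longrightarrow> x < n \<Longrightarrow> (\<Sum>y<n. of_real (B $$ (x, y)) * f r y) = b r * f r x"
    and C: "\<And>r x. r < n \<Longrightarrow> x < n \<Longrightarrow> (\<Sum>y<n. of_real (B $$ (y, x)) * f r y) = c r * f r x"
    and H: "\<And>r x. r < n \<Longrightarrow> x < n \<Longrightarrow> (\<Sum>y<n. of_real (H $$ (x, y)) * f r y) = h r * f r x"
    and zero: "\<And>r. r < n \<Longrightarrow> h r = 0 \<Longrightarrow> b r = 0 \<and> c r = 0"
    and e: "\<And>r. r < n \<Longrightarrow> of_real (e r) = a r - b r * c r / h r"
  shows "has_eigenvalues (A - B * G * transpose_mat B) (map e [0..<n])"
proof -
  let ?c = "map_mat complex_of_real"
  define F where "F = mat n n (\<lambda>(x, r). f r x)"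
  \<comment> \<open>By orthogonality, the conjugate transpose of \<open>F\<close> divided by
    \<open>n\<close> is its inverse.\<close>
  define F' where "F' = mat n n (\<lambda>(r, x). cnj (f r x) / of_nat n)"
  have F: "F \<in> carrier_mat n n" "F' \<in> carrier_mat n n" by (auto simp: F_def F'_def)
  have F'F: "F' * F = 1\<^sub>m n"
    using orth n by (intro eq_matI)
      (auto simp: F_def F'_def scalar_prod_def atLeast0LessThan simp flip: sum_divide_distrib)
  have FF': "F * F' = 1\<^sub>m n" using mat_mult_left_right_inverse[OF F(2,1) F'F] .
  have diag: "?c X * F = F * mat_diag n l"
    if "X \<in> carrier_mat n n"
      "\<And>r x. r < n \<Longrightarrow> x < n \<Longrightarrow> (\<Sum>y<n. of_real (X $$ (x, y)) * f r y) = l r * f r x" for X l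
    using that
    unfolding mat_diag_mult_right[OF F(1)]
    by (intro eq_matI) (auto simp: scalar_prod_def F_def atLeast0LessThan mult.commute)
  have "(?c A - ?c B * ?c G * ?c (transpose_mat B)) * F = F * mat_diag n (\<lambda>r. a r - b r * c r / h r)"
  proof (rule schur_complement_diagonalized[where H = "?c H" and F' = F'])
    show "?c H * ?c G * ?c H = ?c H"
      using G carr of_real_hom.mat_hom_mult[where ?'a = complex] by (metis mult_carrier_mat)
    show "?c A * F = F * mat_diag n a" "?c B * F = F * mat_diag n b" "?c H * F = F * mat_diag n h"
      using carr A B H by (auto intro!: diag)
    show "?c (transpose_mat B) * F = F * mat_diag n c"
      using carr C by (intro diag) auto
  qed (use carr F FF' zero in auto)
  moreover have "?c A - ?c B * ?c G * ?c (transpose_mat B) = ?c (A - B * G * transpose_mat B)"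
  proof -
    have "?c (B * G * transpose_mat B) = ?c B * ?c G * ?c (transpose_mat B)"
      using carr of_real_hom.mat_hom_mult[where ?'a = complex] by (metis mult_carrier_mat transpose_carrier_mat)
    moreover have "B * G * transpose_mat B \<in> carrier_mat n n" using carr by auto
    moreover have "?c (A - M) = ?c A - ?c M" if "M \<in> carrier_mat n n" for M
      using carr that by (intro eq_matI) auto
    ultimately show ?thesis by simp
  qed
  moreover have "mat_diag n (\<lambda>r. a r - b r * c r / h r) = mat_diag n (\<lambda>r. of_real (e r))"
    using e by (intro eq_matI) (auto simp: mat_diag_def)
  ultimately have "?c (A - B * G * transpose_mat B) * F = F * mat_diag n (\<lambda>r. of_real (e r))" by simp
  then have "char_poly (?c (A - B * G * transpose_mat B)) = (\<Prod>r\<leftarrow>[0..<n]. [:- of_real (e r), 1:])"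
    using carr F FF' F'F by (intro char_poly_diagonalized) auto
  then show ?thesis unfolding has_eigenvalues_def
    using carr by (intro of_real_char_poly_eqI[of _ n]) (auto simp: o_def)
qed

section \<open>Information matrices of the truncated design\<close>

text \<open>Sums of indicators are to stay sums, rather than become cardinalities or sums over
  intersections, so that they can be expanded and swapped.\<close>

declare sum_of_bool_eq [simp del] sum_mult_of_bool_eq [simp del] sum_of_bool_mult_eq [simp del]

text \<open>The rows of the model matrices are numbered \<open>i * p + k\<close>; this splits a sum
  over rows into subjects and periods.\<close>

lemma sum_div_mod:
  fixes h :: "nat \<Rightarrow> nat \<Rightarrow> 'a :: comm_monoid_add"
  shows "(\<Sum>r<s * p. h (r div p) (r mod p)) = (\<Sum>i<s. \<Sum>k<p. h i k)"
proof -
  have "(\<Sum>r<s * p. h (r div p) (r mod p)) = (\<Sum>i<s. \<Sum>r = i * p..<i * p + p. h (r div p) (r mod p))"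
    by (rule sum.nat_group[symmetric])
  also have "\<dots> = (\<Sum>i<s. \<Sum>k<p. h i k)"
  proof (rule sum.cong[OF refl])
    fix i
    have "(\<Sum>r = i * p..<i * p + p. h (r div p) (r mod p)) = (\<Sum>k = 0..<p. h ((k + i * p) div p) ((k + i * p) mod p))"
      using sum.shift_bounds_nat_ivl[of "\<lambda>r. h (r div p) (r mod p)" 0 "i * p" p] by (simp add: add.commute)
    then show "(\<Sum>r = i * p..<i * p + p. h (r div p) (r mod p)) = (\<Sum>k<p. h i k)"
      by (simp add: atLeast0LessThan)
  qed
  finally show ?thesis .
qed

lemma cross_index:
  assumes "X \<in> carrier_mat (s * p) m" "Y \<in> carrier_mat (s * p) n" "a < m" "b < n"
    and "\<And>i k. i < s \<Longrightarrow> k < p \<Longrightarrow> X $$ (i * p + k, a) = x i k"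
    and "\<And>i k. i < s \<Longrightarrow> k < p \<Longrightarrow> Y $$ (i * p + k, b) = y i k"
  shows "cross X Y $$ (a, b) = (\<Sum>i<s. \<Sum>k<p. x i k * y i k)"
proof -
  have "cross X Y $$ (a, b) = (\<Sum>r<s * p. X $$ (r, a) * Y $$ (r, b))"
    using assms(1-4) by (simp add: cross_def scalar_prod_def atLeast0LessThan)
  also have "\<dots> = (\<Sum>r<s * p. x (r div p) (r mod p) * y (r div p) (r mod p))"
  proof (rule sum.cong[OF refl])
    fix r assume "r \<in> {..<s * p}"
    then have "r div p < s" "r mod p < p"
      by (cases "p = 0"; simp add: less_mult_imp_div_less)+
    then show "X $$ (r, a) * Y $$ (r, b) = x (r div p) (r mod p) * y (r div p) (r mod p)"
      using assms(5)[of "r div p" "r mod p"] assms(6)[of "r div p" "r mod p"] by simp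
  qed
  also have "\<dots> = (\<Sum>i<s. \<Sum>k<p. x i k * y i k)" by (rule sum_div_mod)
  finally show ?thesis .
qed

lemma less_mult_add: "i * p + k < s * p" if "i < s" "k < p" for i k p s :: nat
proof -
  have "i * p + k < Suc i * p" using that by simp
  also have "\<dots> \<le> s * p" using that by (intro mult_right_mono) auto
  finally show ?thesis .
qed

lemma model_matrix_carrier:
  "X_S D \<in> carrier_mat (dim_col D * dim_row D) (dim_col D)"
  "X_P D \<in> carrier_mat (dim_col D * dim_row D) (dim_row D)"
  "X_D t D \<in> carrier_mat (dim_col D * dim_row D) t"
  "X_C t D \<in> carrier_mat (dim_col D * dim_row D) t"
  by (auto simp: X_S_def X_P_def X_D_def X_C_def kronecker_def ones_col_def)

lemma model_matrix_index:
  assumes "i < dim_col D" "k < dim_row D"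
  shows "j < dim_col D \<Longrightarrow> X_S D $$ (i * dim_row D + k, j) = of_bool (i = j)"
    and "l < dim_row D \<Longrightarrow> X_P D $$ (i * dim_row D + k, l) = of_bool (k = l)"
    and "a < t \<Longrightarrow> X_D t D $$ (i * dim_row D + k, a) = of_bool (D $$ (k, i) = a)"
    and "a < t \<Longrightarrow> X_C t D $$ (i * dim_row D + k, a) = of_bool (0 < k \<and> D $$ (k - 1, i) = a)"
  using assms less_mult_add[OF assms]
  by (auto simp: X_S_def X_P_def X_D_def X_C_def kronecker_def ones_col_def)

text \<open>\<open>D\<close> is the full design with \<open>t\<close> periods; \<open>E\<close> below is its truncation to the first \<open>t - 1\<close> periods.\<close>

locale extended_design =
  fixes t g :: nat and D :: "nat mat"
  assumes t: "4 \<le> t" and g: "0 < g" and D: "D \<in> carrier_mat t (g * t)"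
    and each_subject: "i < g * t \<Longrightarrow> a < t \<Longrightarrow> (\<Sum>k<t. of_bool (D $$ (k, i) = a)) = (1 :: real)"
    and each_period: "k < t \<Longrightarrow> a < t \<Longrightarrow> (\<Sum>i<g * t. of_bool (D $$ (k, i) = a)) = real g"
    and each_pair: "a < t \<Longrightarrow> b < t \<Longrightarrow>
      (\<Sum>i<g * t. \<Sum>k<t - 1. of_bool (D $$ (Suc k, i) = a) * of_bool (D $$ (k, i) = b)) = real g * of_bool (a \<noteq> b)"
begin

text \<open>This keeps \<open>t - 1\<close> in the form in which it occurs in the facts
  below.\<close>

declare One_nat_def [simp del]

text \<open>The matrix \<open>M\<close> of the introduction. Since rows are numbered from 0,
  \<open>t - 2\<close> and \<open>t - 1\<close> are the last two periods, and their transition is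
  the one that truncation removes.\<close>

definition last_pair :: "nat \<Rightarrow> nat \<Rightarrow> real" where
  "last_pair a b = (\<Sum>i<g * t. of_bool (D $$ (t - 1, i) = a) * of_bool (D $$ (t - 2, i) = b))"

abbreviation E :: "nat mat" where "E \<equiv> first_periods (t - 1) D"

text \<open>\<open>L\<close> marks the treatment of a subject in the dropped period,
  \<open>Q\<close> the one in the last period that is kept.\<close>

abbreviation L :: "nat \<Rightarrow> nat \<Rightarrow> real" where "L a i \<equiv> of_bool (D $$ (t - 1, i) = a)"
abbreviation Q :: "nat \<Rightarrow> nat \<Rightarrow> real" where "Q a i \<equiv> of_bool (D $$ (t - 2, i) = a)"

lemma dimE [simp]: "dim_row E = t - 1" "dim_col E = g * t"
  using D by (auto simp: first_periods_def)

lemma E_index: "k < t - 1 \<Longrightarrow> i < g * t \<Longrightarrow> E $$ (k, i) = D $$ (k, i)"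
  using D by (auto simp: first_periods_def)

lemma X_carrier:
  "X_S E \<in> carrier_mat (g * t * (t - 1)) (g * t)"
  "X_P E \<in> carrier_mat (g * t * (t - 1)) (t - 1)"
  "X_D t E \<in> carrier_mat (g * t * (t - 1)) t"
  "X_C t E \<in> carrier_mat (g * t * (t - 1)) t"
  using model_matrix_carrier[where D = E] by simp_all

lemma X_index:
  assumes "i < g * t" "k < t - 1"
  shows "j < g * t \<Longrightarrow> X_S E $$ (i * (t - 1) + k, j) = of_bool (i = j)"
    and "l < t - 1 \<Longrightarrow> X_P E $$ (i * (t - 1) + k, l) = of_bool (k = l)"
    and "a < t \<Longrightarrow> X_D t E $$ (i * (t - 1) + k, a) = of_bool (D $$ (k, i) = a)"
    and "a < t \<Longrightarrow> X_C t E $$ (i * (t - 1) + k, a) = of_bool (0 < k \<and> D $$ (k - 1, i) = a)"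
  using model_matrix_index[where D = E and i = i and k = k] assms E_index[of k i] E_index[of "k - 1" i]
  by (simp_all add: mult.commute)

lemma cross_transpose:
  assumes "X \<in> carrier_mat m n" "Y \<in> carrier_mat m l"
  shows "cross Y X = transpose_mat (cross X Y)"
  using assms by (simp add: cross_def transpose_mult[of _ n m _ l])

text \<open>In the full design every treatment occurs once per subject; the occurrence is lost
  exactly if it falls into the dropped period.\<close>

lemma sum_direct: "i < g * t \<Longrightarrow> a < t \<Longrightarrow> (\<Sum>k<t - 1. of_bool (D $$ (k, i) = a)) = 1 - L a i"
  using each_subject[of i a] t sum.lessThan_Suc[of "\<lambda>k. of_bool (D $$ (k, i) = a) :: real" "t - 1"]
  by (simp add: Suc_diff_Suc numeral_eq_Suc)

text \<open>Only the first \<open>t - 2\<close> periods have a successor within the truncated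
  design, so occurrences in either of the last two periods of \<open>D\<close> are lost.\<close>

lemma sum_carry: "i < g * t \<Longrightarrow> a < t \<Longrightarrow>
    (\<Sum>k<t - 1. of_bool (0 < k \<and> D $$ (k - 1, i) = a)) = 1 - L a i - Q a i"
proof -
  assume *: "i < g * t" "a < t"
  have "(\<Sum>k<Suc (t - 2). of_bool (0 < k \<and> D $$ (k - 1, i) = a) :: real) = (\<Sum>k<t - 2. of_bool (D $$ (k, i) = a))"
    unfolding sum.lessThan_Suc_shift by simp
  moreover have "(\<Sum>k<Suc (t - 2). of_bool (D $$ (k, i) = a) :: real) = (\<Sum>k<t - 2. of_bool (D $$ (k, i) = a)) + Q a i"
    by simp
  moreover have "Suc (t - 2) = t - 1" using t by simp
  ultimately show ?thesis using sum_direct[OF *] by simp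
qed

section \<open>Incidence matrices of the truncated design\<close>

lemma N_DS: "a < t \<Longrightarrow> i < g * t \<Longrightarrow> cross (X_D t E) (X_S E) $$ (a, i) = 1 - L a i"
proof -
  assume *: "a < t" "i < g * t"
  have "cross (X_D t E) (X_S E) $$ (a, i)
    = (\<Sum>j<g * t. \<Sum>k<t - 1. of_bool (D $$ (k, j) = a) * of_bool (j = i))"
    by (rule cross_index[OF X_carrier(3,1)]) (use * X_index in auto)
  also have "\<dots> = (\<Sum>j<g * t. if j = i then \<Sum>k<t - 1. of_bool (D $$ (k, j) = a) else 0)"
    by (intro sum.cong) auto
  also have "\<dots> = 1 - L a i" using * sum_direct by simp
  finally show ?thesis .
qed

lemma N_CS: "a < t \<Longrightarrow> i < g * t \<Longrightarrow> cross (X_C t E) (X_S E) $$ (a, i) = 1 - L a i - Q a i"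
proof -
  assume *: "a < t" "i < g * t"
  have "cross (X_C t E) (X_S E) $$ (a, i)
    = (\<Sum>j<g * t. \<Sum>k<t - 1. of_bool (0 < k \<and> D $$ (k - 1, j) = a) * of_bool (j = i))"
    by (rule cross_index[OF X_carrier(4,1)]) (use * X_index in auto)
  also have "\<dots> = (\<Sum>j<g * t. if j = i then \<Sum>k<t - 1. of_bool (0 < k \<and> D $$ (k - 1, j) = a) else 0)"
    by (intro sum.cong) auto
  also have "\<dots> = 1 - L a i - Q a i" using * sum_carry by simp
  finally show ?thesis .
qed

lemma N_DP: "a < t \<Longrightarrow> l < t - 1 \<Longrightarrow> cross (X_D t E) (X_P E) $$ (a, l) = g"
proof -
  assume *: "a < t" "l < t - 1"
  have "cross (X_D t E) (X_P E) $$ (a, l)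
    = (\<Sum>j<g * t. \<Sum>k<t - 1. of_bool (D $$ (k, j) = a) * of_bool (k = l))"
    by (rule cross_index[OF X_carrier(3,2)]) (use * X_index in auto)
  also have "\<dots> = (\<Sum>j<g * t. \<Sum>k<t - 1. if k = l then of_bool (D $$ (k, j) = a) else 0)"
    by (intro sum.cong) auto
  also have "\<dots> = g" using * each_period[of l a] by simp
  finally show ?thesis .
qed

lemma N_CP: "a < t \<Longrightarrow> l < t - 1 \<Longrightarrow> cross (X_C t E) (X_P E) $$ (a, l) = (if l = 0 then 0 else real g)"
proof -
  assume *: "a < t" "l < t - 1"
  have "cross (X_C t E) (X_P E) $$ (a, l)
    = (\<Sum>j<g * t. \<Sum>k<t - 1. of_bool (0 < k \<and> D $$ (k - 1, j) = a) * of_bool (k = l))"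
    by (rule cross_index[OF X_carrier(4,2)]) (use * X_index in auto)
  also have "\<dots> = (\<Sum>j<g * t. \<Sum>k<t - 1. if k = l then of_bool (0 < k \<and> D $$ (k - 1, j) = a) else 0)"
    by (intro sum.cong) auto
  also have "\<dots> = (if l = 0 then 0 else real g)" using * each_period[of "l - 1" a] by simp
  finally show ?thesis .
qed

text \<open>Balance fixes the number of transitions in the full design; the truncated one lacks
  precisely the last transition of each subject.\<close>

lemma N_DC: "a < t \<Longrightarrow> b < t \<Longrightarrow> cross (X_D t E) (X_C t E) $$ (a, b) = g * of_bool (a \<noteq> b) - last_pair a b"
proof -
  assume *: "a < t" "b < t"
  have t1: "Suc (t - 2) = t - 1" using t by simp
  have "cross (X_D t E) (X_C t E) $$ (a, b)
    = (\<Sum>i<g * t. \<Sum>k<t - 1. of_bool (D $$ (k, i) = a) * of_bool (0 < k \<and> D $$ (k - 1, i) = b))"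
    by (rule cross_index[OF X_carrier(3,4)]) (use * X_index in auto)
  also have "\<dots> = (\<Sum>i<g * t. \<Sum>k<t - 2. of_bool (D $$ (Suc k, i) = a) * of_bool (D $$ (k, i) = b))"
    unfolding t1[symmetric] sum.lessThan_Suc_shift by simp
  also have "\<dots> = (\<Sum>i<g * t. (\<Sum>k<t - 1. of_bool (D $$ (Suc k, i) = a) * of_bool (D $$ (k, i) = b))
      - L a i * Q b i)"
  proof (rule sum.cong[OF refl])
    fix i
    have "Suc (t - 2) - 1 = t - 2" "Suc (t - 2) = t - 1" using t by auto
    then show "(\<Sum>k<t - 2. of_bool (D $$ (Suc k, i) = a) * of_bool (D $$ (k, i) = b) :: real)
      = (\<Sum>k<t - 1. of_bool (D $$ (Suc k, i) = a) * of_bool (D $$ (k, i) = b)) - L a i * Q b i"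
      using sum.lessThan_Suc[of "\<lambda>k. of_bool (D $$ (Suc k, i) = a) * of_bool (D $$ (k, i) = b) :: real" "t - 2"]
      by simp
  qed
  also have "\<dots> = g * of_bool (a \<noteq> b) - last_pair a b"
    using each_pair[OF *] by (simp add: sum_subtractf last_pair_def)
  finally show ?thesis .
qed

lemma sum_L [simp]: "a < t \<Longrightarrow> (\<Sum>i<g * t. L a i) = g"
  and sum_Q [simp]: "a < t \<Longrightarrow> (\<Sum>i<g * t. Q a i) = g"
  using each_period[of "t - 1" a] each_period[of "t - 2" a] t by auto

text \<open>A subject has a single treatment in a given period, so the two indicators can both be 1
  only if \<open>a = b\<close>.\<close>

lemma sum_LL: "a < t \<Longrightarrow> (\<Sum>i<g * t. L a i * L b i) = g * of_bool (a = b)"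
  and sum_QQ: "a < t \<Longrightarrow> (\<Sum>i<g * t. Q a i * Q b i) = g * of_bool (a = b)"
proof -
  assume a: "a < t"
  have "(\<Sum>i<g * t. L a i * L b i) = (\<Sum>i<g * t. L a i) * of_bool (a = b)"
    unfolding sum_distrib_right by (intro sum.cong) auto
  then show "(\<Sum>i<g * t. L a i * L b i) = g * of_bool (a = b)" using a by simp
  have "(\<Sum>i<g * t. Q a i * Q b i) = (\<Sum>i<g * t. Q a i) * of_bool (a = b)"
    unfolding sum_distrib_right by (intro sum.cong) auto
  then show "(\<Sum>i<g * t. Q a i * Q b i) = g * of_bool (a = b)" using a by simp
qed

lemma sum_LQ: "(\<Sum>i<g * t. L a i * Q b i) = last_pair a b"
  and sum_QL: "(\<Sum>i<g * t. Q a i * L b i) = last_pair b a"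
  by (simp_all add: last_pair_def mult.commute)

lemma N_carrier:
  "cross (X_D t E) (X_S E) \<in> carrier_mat t (g * t)"
  "cross (X_C t E) (X_S E) \<in> carrier_mat t (g * t)"
  "cross (X_D t E) (X_P E) \<in> carrier_mat t (t - 1)"
  "cross (X_C t E) (X_P E) \<in> carrier_mat t (t - 1)"
  "cross (X_D t E) (X_C t E) \<in> carrier_mat t t"
  using X_carrier unfolding cross_def by auto

lemma mult_transpose_index:
  assumes "A \<in> carrier_mat m n" "B \<in> carrier_mat l n" "i < m" "j < l"
  shows "(A * transpose_mat B) $$ (i, j) = (\<Sum>k<n. A $$ (i, k) * B $$ (j, k))"
  using assms by (simp add: scalar_prod_def atLeast0LessThan)

section \<open>Replication vectors and products of incidence matrices\<close>

lemma r_D: "r_D t E = mat t 1 (\<lambda>_. g * (real t - 1))"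
proof (rule eq_matI)
  fix a j assume "a < dim_row (mat t 1 (\<lambda>_. g * (real t - 1)))" "j < dim_col (mat t 1 (\<lambda>_. g * (real t - 1)))"
  then have *: "a < t" "j = 0" by auto
  then have "r_D t E $$ (a, j) = (\<Sum>i<g * t. 1 - L a i)"
    using N_carrier(1) by (simp add: r_D_def scalar_prod_def ones_col_def atLeast0LessThan N_DS)
  then show "r_D t E $$ (a, j) = mat t 1 (\<lambda>_. g * (real t - 1)) $$ (a, j)"
    using * by (simp add: sum_subtractf right_diff_distrib)
qed (use N_carrier(1) in \<open>auto simp: r_D_def ones_col_def\<close>)

lemma r_C: "r_C t E = mat t 1 (\<lambda>_. g * (real t - 2))"
proof (rule eq_matI)
  fix a j assume "a < dim_row (mat t 1 (\<lambda>_. g * (real t - 2)))" "j < dim_col (mat t 1 (\<lambda>_. g * (real t - 2)))"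
  then have *: "a < t" "j = 0" by auto
  then have "r_C t E $$ (a, j) = (\<Sum>i<g * t. 1 - L a i - Q a i)"
    using N_carrier(2) by (simp add: r_C_def scalar_prod_def ones_col_def atLeast0LessThan N_CS)
  then show "r_C t E $$ (a, j) = mat t 1 (\<lambda>_. g * (real t - 2)) $$ (a, j)"
    using * by (simp add: sum_subtractf right_diff_distrib)
qed (use N_carrier(2) in \<open>auto simp: r_C_def ones_col_def\<close>)

lemma N_DS_SD: "a < t \<Longrightarrow> b < t \<Longrightarrow>
    (cross (X_D t E) (X_S E) * cross (X_S E) (X_D t E)) $$ (a, b) = g * (real t - 2) + g * of_bool (a = b)"
  unfolding cross_transpose[OF X_carrier(3,1)]
  by (subst mult_transpose_index[OF N_carrier(1,1)])
     (simp_all add: N_DS sum_LL algebra_simps sum_subtractf sum.distrib)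

lemma N_DS_SC: "a < t \<Longrightarrow> b < t \<Longrightarrow>
    (cross (X_D t E) (X_S E) * cross (X_S E) (X_C t E)) $$ (a, b)
      = g * (real t - 3) + g * of_bool (a = b) + last_pair a b"
  unfolding cross_transpose[OF X_carrier(4,1)]
  by (subst mult_transpose_index[OF N_carrier(1,2)])
     (simp_all add: N_DS N_CS sum_LL sum_LQ algebra_simps sum_subtractf sum.distrib)

text \<open>Expanding the product over \<open>g * t\<close> subjects, the four linear terms each
  subtract \<open>g\<close>, the two pure products give the diagonal, and the two mixed ones give
  \<open>M\<close> and its transpose. The other products with \<open>N_DS\<close> expand in the same
  way.\<close>

lemma N_CS_SC: "a < t \<Longrightarrow> b < t \<Longrightarrow>
    (cross (X_C t E) (X_S E) * cross (X_S E) (X_C t E)) $$ (a, b)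
      = g * (real t - 4) + 2 * g * of_bool (a = b) + last_pair a b + last_pair b a"
  unfolding cross_transpose[OF X_carrier(4,1)]
  by (subst mult_transpose_index[OF N_carrier(2,2)])
     (simp_all add: N_CS sum_LL sum_QQ sum_LQ sum_QL algebra_simps sum_subtractf sum.distrib)

lemma sum_carry_periods: "(\<Sum>l<t - 1. if l = 0 then 0 else c) = (real t - 2) * c"
proof -
  have "(\<Sum>l<Suc (t - 2). if l = 0 then 0 else c) = (real t - 2) * c"
    unfolding sum.lessThan_Suc_shift using t by (simp add: of_nat_diff)
  moreover have "Suc (t - 2) = t - 1" using t by simp
  ultimately show ?thesis by simp
qed

lemma N_DP_PD: "a < t \<Longrightarrow> b < t \<Longrightarrow>
    (cross (X_D t E) (X_P E) * cross (X_P E) (X_D t E)) $$ (a, b) = (real t - 1) * (g * g)"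
  unfolding cross_transpose[OF X_carrier(3,2)]
  by (subst mult_transpose_index[OF N_carrier(3,3)]) (use t in \<open>simp_all add: N_DP of_nat_diff\<close>)

lemma N_DP_PC: "a < t \<Longrightarrow> b < t \<Longrightarrow>
    (cross (X_D t E) (X_P E) * cross (X_P E) (X_C t E)) $$ (a, b) = (real t - 2) * (g * g)"
  unfolding cross_transpose[OF X_carrier(4,2)]
  by (subst mult_transpose_index[OF N_carrier(3,4)])
     (simp_all add: N_DP N_CP sum_carry_periods if_distrib cong: if_cong)

lemma N_CP_PC: "a < t \<Longrightarrow> b < t \<Longrightarrow>
    (cross (X_C t E) (X_P E) * cross (X_P E) (X_C t E)) $$ (a, b) = (real t - 2) * (g * g)"
  unfolding cross_transpose[OF X_carrier(4,2)]
  by (subst mult_transpose_index[OF N_carrier(4,4)])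
     (simp_all add: N_CP sum_carry_periods if_distrib cong: if_cong)

lemma mult_transpose_const_col:
  "a < t \<Longrightarrow> b < t \<Longrightarrow> (mat t 1 (\<lambda>_. x) * transpose_mat (mat t 1 (\<lambda>_. y))) $$ (a, b) = (x * y :: real)"
  by (simp add: scalar_prod_def)

lemma C_carrier: "C11 t E \<in> carrier_mat t t" "C12 t E \<in> carrier_mat t t" "C22 t E \<in> carrier_mat t t"
  using X_carrier unfolding C11_def C12_def C22_def Let_def cross_def r_D_def r_C_def by auto

lemma nonzero: "real t - 1 \<noteq> 0" "real t \<noteq> 0" "real g \<noteq> 0"
  using t g by auto

section \<open>Closed forms of the information blocks\<close>

lemma C11_index:
  assumes "a < t" "b < t"
  shows "C11 t E $$ (a, b) = g * t * (real t - 2) / (real t - 1) * of_bool (a = b) - g * (real t - 2) / (real t - 1)"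
proof -
  have "C11 t E $$ (a, b) = g * (real t - 1) * of_bool (a = b)
     + 1 / ((real t - 1) * (g * t)) * ((g * (real t - 1)) * (g * (real t - 1)))
     - 1 / (real t - 1) * (g * (real t - 2) + g * of_bool (a = b))
     - 1 / (g * t) * ((real t - 1) * (g * g))"
    unfolding C11_def Let_def r_D
    using assms N_carrier X_carrier t N_DS_SD[OF assms] N_DP_PD[OF assms] mult_transpose_const_col[OF assms]
    by (simp add: diag_of_col_def mat_diag_def of_nat_diff cross_def)
  also have "\<dots> = g * t * (real t - 2) / (real t - 1) * of_bool (a = b) - g * (real t - 2) / (real t - 1)"
    using nonzero
    by (cases "a = b"; simp add: divide_simps; simp add: algebra_simps power2_eq_square)
  finally show ?thesis .
qed

lemma C12_index:
  assumes "a < t" "b < t"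
  shows "C12 t E $$ (a, b) = 2 * g / (real t - 1) - t / (real t - 1) * (g * of_bool (a = b) + last_pair a b)"
proof -
  have "C12 t E $$ (a, b) = (g * of_bool (a \<noteq> b) - last_pair a b)
     + 1 / ((real t - 1) * (g * t)) * ((g * (real t - 1)) * (g * (real t - 2)))
     - 1 / (real t - 1) * (g * (real t - 3) + g * of_bool (a = b) + last_pair a b)
     - 1 / (g * t) * ((real t - 2) * (g * g))"
    unfolding C12_def Let_def r_D r_C
    using assms N_carrier X_carrier t N_DC[OF assms] N_DS_SC[OF assms] N_DP_PC[OF assms] mult_transpose_const_col[OF assms]
    by (simp add: of_nat_diff cross_def)
  also have "\<dots> = 2 * g / (real t - 1) - t / (real t - 1) * (g * of_bool (a = b) + last_pair a b)"
    using nonzero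
    by (cases "a = b"; simp add: divide_simps; simp add: algebra_simps power2_eq_square)
  finally show ?thesis .
qed

lemma C22_index:
  assumes "a < t" "b < t"
  shows "C22 t E $$ (a, b) = (g * t * (real t - 3) * of_bool (a = b) - (last_pair a b + last_pair b a)
    - g * (real t ^ 2 - 3 * real t - 2) / t) / (real t - 1)"
proof -
  have "C22 t E $$ (a, b) = g * (real t - 2) * of_bool (a = b)
     + 1 / ((real t - 1) * (g * t)) * ((g * (real t - 2)) * (g * (real t - 2)))
     - 1 / (real t - 1) * (g * (real t - 4) + 2 * g * of_bool (a = b) + last_pair a b + last_pair b a)
     - 1 / (g * t) * ((real t - 2) * (g * g))"
    unfolding C22_def Let_def r_C
    using assms N_carrier X_carrier t N_CS_SC[OF assms] N_CP_PC[OF assms] mult_transpose_const_col[OF assms]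
    by (simp add: diag_of_col_def mat_diag_def of_nat_diff cross_def)
  also have "\<dots> = (g * t * (real t - 3) * of_bool (a = b) - (last_pair a b + last_pair b a)
    - g * (real t ^ 2 - 3 * real t - 2) / t) / (real t - 1)"
    using nonzero
    by (cases "a = b"; simp add: divide_simps; simp add: algebra_simps power2_eq_square)
  finally show ?thesis .
qed

end

text \<open>\<open>g \<mu> r\<close> and \<open>g \<nu> r\<close> are the eigenvalues of the matrix \<open>M\<close> and of its transpose.\<close>

lemma (in extended_design) direct_info_eigenvalues:
  fixes f :: "nat \<Rightarrow> nat \<Rightarrow> complex" and \<mu> \<nu> :: "nat \<Rightarrow> complex" and \<kappa> e :: "nat \<Rightarrow> real"
  assumes orth: "\<And>r r'. r < t \<Longrightarrow> r' < t \<Longrightarrow> (\<Sum>a<t. cnj (f r a) * f r' a) = (if r = r' then of_nat t else 0)"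
    and f0: "\<And>a. f 0 a = 1"
    and mu: "\<And>r x. r < t \<Longrightarrow> x < t \<Longrightarrow> (\<Sum>y<t. of_real (last_pair x y) * f r y) = of_nat g * \<mu> r * f r x"
    and nu: "\<And>r x. r < t \<Longrightarrow> x < t \<Longrightarrow> (\<Sum>y<t. of_real (last_pair y x) * f r y) = of_nat g * \<nu> r * f r x"
    and mu_add_nu: "\<And>r. r < t \<Longrightarrow> \<mu> r + \<nu> r = of_real (2 * cos (2 * pi * r / t))"
    and mu_nu: "\<And>r. r < t \<Longrightarrow> (1 + \<mu> r) * (1 + \<nu> r) = of_real (\<kappa> r)"
    and mu0: "\<mu> 0 = 1" and nu0: "\<nu> 0 = 1"
    and e0: "e 0 = 0"
    and e: "\<And>r. 0 < r \<Longrightarrow> r < t \<Longrightarrow> e r = real t / (real t - 1) *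
      (real t - 2 - real t * \<kappa> r / (real t * (real t - 3) - 2 * cos (2 * pi * r / t)))"
    and G: "generalized_inverse (C22 t E) G"
  shows "has_eigenvalues (direct_info_mat t E G) (map (\<lambda>r. g * e r) [0..<t])"
proof -
  define u :: complex where "u = of_nat t - 1"
  have u: "u = of_real (real t - 1)" by (simp add: u_def)
  have "complex_of_real (real t - 1) \<noteq> 0" using nonzero(1) by (simp only: of_real_eq_0_iff) simp
  then have u0: "u \<noteq> 0" unfolding u .
  \<comment> \<open>The eigenvalue of the all-ones matrix on \<open>f r\<close>; as
    \<open>f 0\<close> is constant, it follows from the orthogonality of \<open>f r\<close> to
    \<open>f 0\<close>.\<close>
  define J :: "nat \<Rightarrow> complex" where "J = (\<lambda>r. if r = 0 then of_nat t else 0)"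
  have sumJ: "(\<Sum>y<t. f r y) = J r * f r x" if "r < t" for r x
    using orth[of 0 r] that t f0 by (simp add: J_def)
  have sumI: "(\<Sum>y<t. of_bool (x = y) * f r y) = f r x" if "x < t" for r x
  proof -
    have "(\<Sum>y<t. of_bool (x = y) * f r y) = (\<Sum>y<t. if x = y then f r y else 0)"
      by (intro sum.cong) auto
    then show ?thesis using that by simp
  qed
  let ?n = "of_nat t :: complex" and ?g = "of_nat g :: complex"
  \<comment> \<open>The four eigenvalue functions arise from the closed forms of the blocks
    (\<open>c\<close> belongs to the transpose of \<open>C12\<close>) by replacing the identity, the
    all-ones matrix, \<open>M\<close> and its transpose with their eigenvalues; \<open>u\<close> is
    the common denominator \<open>t - 1\<close>.\<close>
  define a where "a = (\<lambda>r. ?g * ?n * (?n - 2) / u - ?g * (?n - 2) / u * J r)"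
  define b where "b = (\<lambda>r. 2 * ?g / u * J r - ?n / u * (?g + ?g * \<mu> r))"
  define c where "c = (\<lambda>r. 2 * ?g / u * J r - ?n / u * (?g + ?g * \<nu> r))"
  define h where "h = (\<lambda>r. ?g * ?n * (?n - 3) / u - (?g * \<mu> r + ?g * \<nu> r) / u - ?g * (?n ^ 2 - 3 * ?n - 2) / ?n / u * J r)"
  have A: "(\<Sum>y<t. of_real (C11 t E $$ (x, y)) * f r y) = a r * f r x" if "r < t" "x < t" for r x
  proof -
    have "(\<Sum>y<t. of_real (C11 t E $$ (x, y)) * f r y)
      = (\<Sum>y<t. ?g * ?n * (?n - 2) / u * (of_bool (x = y) * f r y) - ?g * (?n - 2) / u * f r y)"
      using that by (intro sum.cong refl) (auto simp: C11_index u algebra_simps)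
    also have "\<dots> = ?g * ?n * (?n - 2) / u * f r x - ?g * (?n - 2) / u * (J r * f r x)"
      using that by (simp only: sum_subtractf sumI sumJ[of r x] flip: sum_distrib_left)
    also have "\<dots> = a r * f r x"
      by (simp add: a_def left_diff_distrib)
    finally show ?thesis .
  qed
  have B: "(\<Sum>y<t. of_real (C12 t E $$ (x, y)) * f r y) = b r * f r x" if "r < t" "x < t" for r x
  proof -
    have "(\<Sum>y<t. of_real (C12 t E $$ (x, y)) * f r y)
      = (\<Sum>y<t. 2 * ?g / u * f r y - (?n / u * ?g * (of_bool (x = y) * f r y) + ?n / u * (of_real (last_pair x y) * f r y)))"
      using that by (intro sum.cong refl) (auto simp: C12_index u algebra_simps)
    also have "\<dots> = 2 * ?g / u * (J r * f r x) - (?n / u * ?g * f r x + ?n / u * (?g * \<mu> r * f r x))"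
      using that by (simp only: sum_subtractf sum.distrib sumI sumJ[of r x] mu flip: sum_distrib_left)
    also have "\<dots> = b r * f r x"
      by (simp add: b_def left_diff_distrib distrib_left distrib_right mult.assoc)
    finally show ?thesis .
  qed
  have C: "(\<Sum>y<t. of_real (C12 t E $$ (y, x)) * f r y) = c r * f r x" if "r < t" "x < t" for r x
  proof -
    have "(\<Sum>y<t. of_real (C12 t E $$ (y, x)) * f r y)
      = (\<Sum>y<t. 2 * ?g / u * f r y - (?n / u * ?g * (of_bool (x = y) * f r y) + ?n / u * (of_real (last_pair y x) * f r y)))"
      using that by (intro sum.cong refl) (auto simp: C12_index u algebra_simps)
    also have "\<dots> = 2 * ?g / u * (J r * f r x) - (?n / u * ?g * f r x + ?n / u * (?g * \<nu> r * f r x))"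
      using that by (simp only: sum_subtractf sum.distrib sumI sumJ[of r x] nu flip: sum_distrib_left)
    also have "\<dots> = c r * f r x"
      by (simp add: c_def left_diff_distrib distrib_left distrib_right mult.assoc)
    finally show ?thesis .
  qed
  have H: "(\<Sum>y<t. of_real (C22 t E $$ (x, y)) * f r y) = h r * f r x" if "r < t" "x < t" for r x
  proof -
    have "(\<Sum>y<t. of_real (C22 t E $$ (x, y)) * f r y)
      = (\<Sum>y<t. ?g * ?n * (?n - 3) / u * (of_bool (x = y) * f r y)
          - (1 / u * (of_real (last_pair x y) * f r y) + 1 / u * (of_real (last_pair y x) * f r y))
          - ?g * (?n ^ 2 - 3 * ?n - 2) / ?n / u * f r y)"
      using that by (intro sum.cong refl) (auto simp: C22_index u algebra_simps diff_divide_distrib add_divide_distrib)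
    also have "\<dots> = ?g * ?n * (?n - 3) / u * f r x - (1 / u * (?g * \<mu> r * f r x) + 1 / u * (?g * \<nu> r * f r x))
          - ?g * (?n ^ 2 - 3 * ?n - 2) / ?n / u * (J r * f r x)"
      using that by (simp only: sum_subtractf sum.distrib sumI sumJ[of r x] mu nu flip: sum_distrib_left)
    also have "\<dots> = h r * f r x"
      by (simp add: h_def left_diff_distrib add_divide_distrib distrib_right)
    finally show ?thesis .
  qed
  \<comment> \<open>On the constant vector the all-ones part cancels the rest, which yields the
    eigenvalue 0.\<close>
  have zero: "a 0 = 0" "b 0 = 0" "c 0 = 0"
    using u0 t by (simp_all add: a_def b_def c_def J_def mu0 nu0)
  define d where "d = (\<lambda>r :: nat. real t * (real t - 3) - 2 * cos (2 * pi * r / t))"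
  \<comment> \<open>\<open>d r\<close> is the denominator in the claimed eigenvalues. For
    \<open>t \<ge> 4\<close>, \<open>t * (t - 3)\<close> is at least 4, whereas twice a cosine is at
    most 2.\<close>
  have d: "0 < d r" for r
  proof -
    have "real t * 1 \<le> real t * (real t - 3)" using t by (intro mult_left_mono) auto
    then have "4 \<le> real t * (real t - 3)" using t by linarith
    moreover have "cos (2 * pi * r / t) \<le> 1" by simp
    ultimately show ?thesis unfolding d_def by linarith
  qed
  have h: "h r = ?g * of_real (d r) / u" if "0 < r" "r < t" for r
  proof -
    have "h r = ?g * (?n * (?n - 3) - (\<mu> r + \<nu> r)) / u"
      using that u0 by (simp add: h_def J_def field_simps)
    then show ?thesis unfolding mu_add_nu[OF that(2)] d_def by simp
  qed
  have nz: "h r \<noteq> 0" if "0 < r" "r < t" for r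
    using h[OF that] d[of r] u0 g by simp
  have e': "of_real (g * e r) = a r - b r * c r / h r" if "r < t" for r
  proof (cases "r = 0")
    case True
    then show ?thesis using zero e0 by simp
  next
    case False
    then have r: "0 < r" "r < t" using that by auto
    have dr: "complex_of_real (d r) \<noteq> 0" using d[of r] by simp
    \<comment> \<open>Away from \<open>r = 0\<close> the all-ones part vanishes, so only the product
      that defines \<open>\<kappa>\<close> remains.\<close>
    have "b r * c r = (?n / u)\<^sup>2 * ?g\<^sup>2 * ((1 + \<mu> r) * (1 + \<nu> r))"
      using False by (simp add: b_def c_def J_def power2_eq_square field_simps)
    then have bc: "b r * c r = (?n / u)\<^sup>2 * ?g\<^sup>2 * of_real (\<kappa> r)"
      using mu_nu[OF that] by simp
    have "a r - b r * c r / h r = ?g * (?n / u * (?n - 2 - ?n * of_real (\<kappa> r) / of_real (d r)))"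
      using u0 dr g False unfolding bc h[OF r]
      by (simp add: a_def J_def field_simps power2_eq_square)
    also have "\<dots> = of_real (g * e r)"
      unfolding e[OF r] u by (simp add: d_def)
    finally show ?thesis by simp
  qed
  \<comment> \<open>\<open>C22\<close> can be singular only along the constant vector, where
    \<open>b\<close> and \<open>c\<close> vanish too.\<close>
  have "h r = 0 \<longrightarrow> b r = 0 \<and> c r = 0" if "r < t" for r
    using nz[of r] that zero by (cases "r = 0") auto
  then show ?thesis
    unfolding direct_info_mat_def
    using C_carrier G t A B C H orth e'
    by (intro schur_complement_eigenvalues[where H = "C22 t E" and f = f and a = a and b = b and c = c and h = h])
       (auto simp: generalized_inverse_def)
qed

section \<open>Counting in uniform balanced designs\<close>

lemma sum_of_bool_card: "finite S \<Longrightarrow> (\<Sum>x\<in>S. of_bool (P x)) = real (card {x \<in> S. P x})"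
  by (simp add: sum_of_bool_eq Collect_conj_eq)

text \<open>The \<open>t\<close> fibres partition a set of \<open>n * t\<close> elements into parts
  of equal size.\<close>

lemma card_equal_fibres:
  fixes h :: "'a \<Rightarrow> nat"
  assumes "finite S" "\<And>x. x \<in> S \<Longrightarrow> h x < t" "a < t" "card S = n * t"
    and eq: "\<And>a b. a < t \<Longrightarrow> b < t \<Longrightarrow> card {x \<in> S. h x = a} = card {x \<in> S. h x = b}"
  shows "card {x \<in> S. h x = a} = n"
proof -
  have "card S = (\<Sum>b<t. card {x \<in> S. h x = b})"
    using assms(1,2) sum.group[of S "{..<t}" h "\<lambda>_. 1 :: nat"] by (simp add: image_subset_iff)
  also have "\<dots> = (\<Sum>b<t. card {x \<in> S. h x = a})"
    using assms(3) by (intro sum.cong refl eq) auto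
  finally show ?thesis using assms(3,4) by simp
qed

lemma preceded_count_sum:
  assumes "V \<in> carrier_mat t s"
  shows "real (preceded_count V a b)
    = (\<Sum>i<s. \<Sum>k<t - 1. of_bool (V $$ (Suc k, i) = a) * of_bool (V $$ (k, i) = b))"
proof -
  have "(\<Sum>i<s. \<Sum>k<t - 1. of_bool (V $$ (Suc k, i) = a) * of_bool (V $$ (k, i) = b))
      = (\<Sum>k<t - 1. \<Sum>i<s. of_bool (V $$ (Suc k, i) = a \<and> V $$ (k, i) = b) :: real)"
    unfolding of_bool_conj by (rule sum.swap)
  also have "\<dots> = (\<Sum>(k, i)\<in>{..<t - 1} \<times> {..<s}. of_bool (V $$ (Suc k, i) = a \<and> V $$ (k, i) = b))"
    by (rule sum.cartesian_product)
  also have "\<dots> = real (card {x \<in> {..<t - 1} \<times> {..<s}. case x of (k, i) \<Rightarrow> V $$ (Suc k, i) = a \<and> V $$ (k, i) = b})"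
    using sum_of_bool_card[of "{..<t - 1} \<times> {..<s}"] by (simp add: case_prod_unfold)
  also have "{x \<in> {..<t - 1} \<times> {..<s}. case x of (k, i) \<Rightarrow> V $$ (Suc k, i) = a \<and> V $$ (k, i) = b}
     = {(k, i). Suc k < dim_row V \<and> i < dim_col V \<and> V $$ (Suc k, i) = a \<and> V $$ (k, i) = b}"
    using assms by auto
  finally show ?thesis by (simp add: preceded_count_def)
qed

text \<open>Uniformity and balance only assert that certain counts are equal; double counting
  determines them. For balance, \<open>n * t\<close> subjects make \<open>t - 1\<close> transitions
  each, spread evenly over \<open>t * (t - 1)\<close> ordered pairs of distinct treatments, so each
  pair occurs \<open>n\<close> times.\<close>

lemma UBRMD_counts:
  assumes V: "UBRMD t n V" and t: "2 \<le> t"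
  shows UBRMD_subject: "\<And>i a. i < n * t \<Longrightarrow> a < t \<Longrightarrow> (\<Sum>k<t. of_bool (V $$ (k, i) = a)) = (1 :: real)"
    and UBRMD_period: "\<And>k a. k < t \<Longrightarrow> a < t \<Longrightarrow> (\<Sum>i<n * t. of_bool (V $$ (k, i) = a)) = real n"
    and UBRMD_pair: "\<And>a b. a < t \<Longrightarrow> b < t \<Longrightarrow>
      (\<Sum>i<n * t. \<Sum>k<t - 1. of_bool (V $$ (Suc k, i) = a) * of_bool (V $$ (k, i) = b)) = real n * of_bool (a \<noteq> b)"
proof -
  have carr: "V \<in> carrier_mat t (n * t)" and ent: "\<And>k i. k < t \<Longrightarrow> i < n * t \<Longrightarrow> V $$ (k, i) < t"
    using V by (auto simp: UBRMD_def design_def)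
  have dims: "dim_row V = t" "dim_col V = n * t" using carr by auto
  have unif: "uniform t V" and bal: "balanced t V" using V by (auto simp: UBRMD_def)
  have unif_subject: "card {k \<in> {..<t}. V $$ (k, i) = a} = card {k \<in> {..<t}. V $$ (k, i) = b}"
    if "i < n * t" "a < t" "b < t" for i a b
    using unif that unfolding uniform_def dims lessThan_iff by blast
  have unif_period: "card {i \<in> {..<n * t}. V $$ (k, i) = a} = card {i \<in> {..<n * t}. V $$ (k, i) = b}"
    if "k < t" "a < t" "b < t" for k a b
    using unif that unfolding uniform_def dims lessThan_iff by blast
  show "(\<Sum>k<t. of_bool (V $$ (k, i) = a)) = (1 :: real)" if "i < n * t" "a < t" for i a
  proof -
    have "card {k \<in> {..<t}. V $$ (k, i) = a} = 1"
      by (rule card_equal_fibres[where t = t, OF _ _ _ _ unif_subject]) (use that ent in simp_all)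
    then show ?thesis by (subst sum_of_bool_card) simp_all
  qed
  show "(\<Sum>i<n * t. of_bool (V $$ (k, i) = a)) = real n" if "k < t" "a < t" for k a
  proof -
    have "card {i \<in> {..<n * t}. V $$ (k, i) = a} = n"
      by (rule card_equal_fibres[where t = t, OF _ _ _ _ unif_period]) (use that ent in simp_all)
    then show ?thesis by (subst sum_of_bool_card) simp_all
  qed
  obtain m where m: "\<And>a b. a < t \<Longrightarrow> b < t \<Longrightarrow> a \<noteq> b \<Longrightarrow> preceded_count V a b = m"
    and m0: "\<And>a. a < t \<Longrightarrow> preceded_count V a a = 0"
    using bal by (auto simp: balanced_def)
  define S where "S = (\<lambda>a b. \<Sum>i<n * t. \<Sum>k<t - 1. of_bool (V $$ (Suc k, i) = a) * of_bool (V $$ (k, i) = b) :: real)"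
  have S: "S a b = real m * of_bool (a \<noteq> b)" if "a < t" "b < t" for a b
    using preceded_count_sum[OF carr, of a b] m[of a b] m0[of a] that
    by (cases "a = b") (simp_all add: S_def)
  have "(\<Sum>a<t. \<Sum>b<t. S a b) = (\<Sum>a<t. real m * (real t - 1))"
  proof (rule sum.cong[OF refl])
    fix a assume a: "a \<in> {..<t}"
    have "(\<Sum>b<t. S a b) = (\<Sum>b<t. real m - (if b = a then real m else 0))"
      using a S by (intro sum.cong) auto
    also have "\<dots> = real m * (real t - 1)"
      using a by (simp add: sum_subtractf right_diff_distrib)
    finally show "(\<Sum>b<t. S a b) = real m * (real t - 1)" .
  qed
  \<comment> \<open>Summing over the treatments first, every transition of every subject contributes
    exactly 1.\<close>
  moreover have "(\<Sum>a<t. \<Sum>b<t. S a b) = real (n * t) * (real t - 1)"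
  proof -
    have one: "(\<Sum>a<t. of_bool (x = a)) = (1 :: real)" if "x < t" for x
      using that by (simp add: of_bool_def)
    have "(\<Sum>a<t. \<Sum>b<t. S a b)
      = (\<Sum>a<t. \<Sum>i<n * t. \<Sum>b<t. \<Sum>k<t - 1. of_bool (V $$ (Suc k, i) = a) * of_bool (V $$ (k, i) = b))"
      unfolding S_def by (rule sum.cong[OF refl]) (rule sum.swap)
    also have "\<dots> = (\<Sum>i<n * t. \<Sum>a<t. \<Sum>k<t - 1. \<Sum>b<t. of_bool (V $$ (Suc k, i) = a) * of_bool (V $$ (k, i) = b))"
      by (rule trans[OF sum.swap], rule sum.cong[OF refl], rule sum.cong[OF refl], rule sum.swap)
    also have "\<dots> = (\<Sum>i<n * t. \<Sum>k<t - 1. \<Sum>a<t. \<Sum>b<t. of_bool (V $$ (Suc k, i) = a) * of_bool (V $$ (k, i) = b))"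
      by (rule sum.cong[OF refl], rule sum.swap)
    also have "\<dots> = (\<Sum>i<n * t. \<Sum>k<t - 1. (\<Sum>a<t. of_bool (V $$ (Suc k, i) = a)) * (\<Sum>b<t. of_bool (V $$ (k, i) = b)))"
      by (simp only: sum_product)
    also have "\<dots> = (\<Sum>i<n * t. \<Sum>k<t - 1. 1)"
    proof (intro sum.cong refl)
      fix i k assume "i \<in> {..<n * t}" "k \<in> {..<t - 1}"
      then have "V $$ (Suc k, i) < t" "V $$ (k, i) < t" using ent by auto
      then show "(\<Sum>a<t. of_bool (V $$ (Suc k, i) = a)) * (\<Sum>b<t. of_bool (V $$ (k, i) = b)) = (1 :: real)"
        by (simp only: one mult_1)
    qed
    finally show ?thesis using t by (simp add: of_nat_diff)
  qed
  ultimately have "real m = real n" using t by simp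
  then show "(\<Sum>i<n * t. \<Sum>k<t - 1. of_bool (V $$ (Suc k, i) = a) * of_bool (V $$ (k, i) = b)) = real n * of_bool (a \<noteq> b)"
    if "a < t" "b < t" for a b
    using S[OF that] by (simp add: S_def)
qed

text \<open>All fibres of the assignment have size \<open>m\<close>, so a sum over subjects is
  \<open>m\<close> times the sum over the columns of the plan.\<close>

lemma assigns_subjects_sum:
  assumes "assigns_subjects m V D"
  obtains c where "\<And>i. i < dim_col D \<Longrightarrow> c i < dim_col V"
    "\<And>k i. k < dim_row V \<Longrightarrow> i < dim_col D \<Longrightarrow> D $$ (k, i) = V $$ (k, c i)"
    "\<And>h :: nat \<Rightarrow> real. (\<Sum>i<dim_col D. h (c i)) = real m * (\<Sum>j<dim_col V. h j)"
proof -
  obtain c where c: "\<And>i. i < dim_col D \<Longrightarrow> c i < dim_col V \<and> col D i = col V (c i)"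
    and card: "\<And>j. j < dim_col V \<Longrightarrow> card {i. i < dim_col D \<and> c i = j} = m"
    using assms unfolding assigns_subjects_def by blast
  have row: "dim_row D = dim_row V" using assms by (simp add: assigns_subjects_def)
  show ?thesis
  proof
    show "c i < dim_col V" if "i < dim_col D" for i using c that by blast
    show "D $$ (k, i) = V $$ (k, c i)" if "k < dim_row V" "i < dim_col D" for k i
      using c[OF that(2)] that row by (metis index_col)
    fix h :: "nat \<Rightarrow> real"
    have "(\<Sum>i<dim_col D. h (c i)) = (\<Sum>j<dim_col V. \<Sum>i\<in>{i \<in> {..<dim_col D}. c i = j}. h (c i))"
      using c by (intro sum.group[symmetric]) auto
    also have "\<dots> = (\<Sum>j<dim_col V. real m * h j)"
      using card by (intro sum.cong) auto
    finally show "(\<Sum>i<dim_col D. h (c i)) = real m * (\<Sum>j<dim_col V. h j)"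
      by (simp add: sum_distrib_left)
  qed
qed

text \<open>Repeating each column \<open>m\<close> times multiplies the counts over subjects by
  \<open>m\<close> and leaves the counts within a subject alone. Class A is the case
  \<open>n = 1\<close>, \<open>m = g\<close>; class B is \<open>n = 2\<close>,
  \<open>m = g div 2\<close>.\<close>

lemma UBRMD_extended_design:
  assumes V: "UBRMD t n V" and asg: "assigns_subjects m V D" and t: "4 \<le> t" and g: "g = m * n" "0 < g"
  shows "extended_design t g D"
    and "extended_design.last_pair t g D a b
      = real m * (\<Sum>j<n * t. of_bool (V $$ (t - 1, j) = a) * of_bool (V $$ (t - 2, j) = b))"
proof -
  have t2: "2 \<le> t" using t by simp
  have carr: "V \<in> carrier_mat t (n * t)" using V by (auto simp: UBRMD_def design_def)
  have dimD: "dim_row D = t" "dim_col D = g * t"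
    using asg carr g by (auto simp: assigns_subjects_def)
  from carr have dimV: "dim_row V = t" "dim_col V = n * t" by auto
  obtain c where c: "\<And>i. i < g * t \<Longrightarrow> c i < n * t"
    and ent: "\<And>k i. k < t \<Longrightarrow> i < g * t \<Longrightarrow> D $$ (k, i) = V $$ (k, c i)"
    and sum: "\<And>h :: nat \<Rightarrow> real. (\<Sum>i<g * t. h (c i)) = real m * (\<Sum>j<n * t. h j)"
    using assigns_subjects_sum[OF asg] unfolding dimD dimV by metis
  show ext: "extended_design t g D"
  proof
    show "D \<in> carrier_mat t (g * t)" using dimD by auto
    show "(\<Sum>k<t. of_bool (D $$ (k, i) = a)) = (1 :: real)" if "i < g * t" "a < t" for i a
    proof -
      have "(\<Sum>k<t. of_bool (D $$ (k, i) = a) :: real) = (\<Sum>k<t. of_bool (V $$ (k, c i) = a))"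
        using ent that by (intro sum.cong) auto
      also have "\<dots> = 1" by (rule UBRMD_subject[OF V t2 c[OF that(1)] that(2)])
      finally show ?thesis .
    qed
    show "(\<Sum>i<g * t. of_bool (D $$ (k, i) = a)) = real g" if "k < t" "a < t" for k a
    proof -
      have "(\<Sum>i<g * t. of_bool (D $$ (k, i) = a) :: real) = (\<Sum>i<g * t. of_bool (V $$ (k, c i) = a))"
        using ent that by (intro sum.cong) auto
      also have "\<dots> = real m * (\<Sum>j<n * t. of_bool (V $$ (k, j) = a))" by (rule sum)
      also have "\<dots> = real g" unfolding UBRMD_period[OF V t2 that] g by simp
      finally show ?thesis .
    qed
    show "(\<Sum>i<g * t. \<Sum>k<t - 1. of_bool (D $$ (Suc k, i) = a) * of_bool (D $$ (k, i) = b)) = real g * of_bool (a \<noteq> b)"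
      if "a < t" "b < t" for a b
    proof -
      have "(\<Sum>i<g * t. \<Sum>k<t - 1. of_bool (D $$ (Suc k, i) = a) * of_bool (D $$ (k, i) = b) :: real)
        = (\<Sum>i<g * t. \<Sum>k<t - 1. of_bool (V $$ (Suc k, c i) = a) * of_bool (V $$ (k, c i) = b))"
        using ent by (intro sum.cong) auto
      also have "\<dots> = real m * (\<Sum>j<n * t. \<Sum>k<t - 1. of_bool (V $$ (Suc k, j) = a) * of_bool (V $$ (k, j) = b))"
        by (rule sum)
      also have "\<dots> = real g * of_bool (a \<noteq> b)" unfolding UBRMD_pair[OF V t2 that] g by simp
      finally show ?thesis .
    qed
  qed (use t g in auto)
  have "extended_design.last_pair t g D a b
      = (\<Sum>i<g * t. of_bool (V $$ (t - 1, c i) = a) * of_bool (V $$ (t - 2, c i) = b))"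
    unfolding extended_design.last_pair_def[OF ext] using ent t by (intro sum.cong) auto
  also have "\<dots> = real m * (\<Sum>j<n * t. of_bool (V $$ (t - 1, j) = a) * of_bool (V $$ (t - 2, j) = b))"
    by (rule sum)
  finally show "extended_design.last_pair t g D a b
      = real m * (\<Sum>j<n * t. of_bool (V $$ (t - 1, j) = a) * of_bool (V $$ (t - 2, j) = b))" .
qed

section \<open>The transition matrix as the permutation matrix of a cycle\<close>

lemma transition_mat_index:
  assumes "a < t" "b < t"
  shows "transition_mat t W $$ (a, b) = (\<Sum>j<t. of_bool (W $$ (t - 1, j) = a) * of_bool (W $$ (t - 2, j) = b))"
  using assms unfolding of_bool_def
  by (auto simp: transition_mat_def treatment_mat_def scalar_prod_def atLeast0LessThan intro!: sum.cong)

lemma bij_betw_of_card_fibres: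
  fixes w :: "nat \<Rightarrow> nat"
  assumes "\<And>a. a < t \<Longrightarrow> card {i. i < t \<and> w i = a} = 1"
  shows "bij_betw w {..<t} {..<t}"
proof -
  have "a \<in> w ` {..<t}" if "a < t" for a
  proof -
    have "{i. i < t \<and> w i = a} \<noteq> {}" using assms[OF that] by force
    then show ?thesis by auto
  qed
  then have sub: "{..<t} \<subseteq> w ` {..<t}" by auto
  have "card (w ` {..<t}) \<le> card {..<t}" by (intro card_image_le) simp
  then have im: "{..<t} = w ` {..<t}" using sub by (intro card_seteq) auto
  then have "inj_on w {..<t}" by (intro eq_card_imp_inj_on) auto
  then show ?thesis using im by (simp add: bij_betw_def)
qed

text \<open>The last two rows of \<open>W\<close> are bijections from columns to treatments, so the
  transition matrix is a permutation matrix. Its simple eigenvalue 1 makes the permutation a single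
  cycle, whose Fourier basis is orthogonal and diagonalizes the matrix and its transpose.\<close>

lemma transition_mat_eigenvectors:
  assumes t: "0 < t" and W: "dim_col W = t" and once: "once_in_last_two_rows t W"
    and ev: "eigenvalue_multiplicity (transition_mat t W) 1 = 1"
  obtains f :: "nat \<Rightarrow> nat \<Rightarrow> complex" where
    "\<And>r r'. r < t \<Longrightarrow> r' < t \<Longrightarrow> (\<Sum>a<t. cnj (f r a) * f r' a) = (if r = r' then of_nat t else 0)"
    "\<And>a. f 0 a = 1"
    "\<And>r x. x < t \<Longrightarrow> (\<Sum>y<t. of_real (transition_mat t W $$ (x, y)) * f r y) = cis (2 * pi * r / t) * f r x"
    "\<And>r x. x < t \<Longrightarrow> (\<Sum>y<t. of_real (transition_mat t W $$ (y, x)) * f r y) = cnj (cis (2 * pi * r / t)) * f r x"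
proof -
  let ?v = "\<lambda>i. W $$ (t - 1, i)" and ?w = "\<lambda>i. W $$ (t - 2, i)"
  have v: "bij_betw ?v {..<t} {..<t}" and w: "bij_betw ?w {..<t} {..<t}"
    using once W by (auto simp: once_in_last_two_rows_def intro!: bij_betw_of_card_fibres)
  define q where "q = inv_into {..<t} ?w"
  have q: "bij_betw q {..<t} {..<t}" unfolding q_def using w by (rule bij_betw_inv_into)
  have wq: "?w i = b \<longleftrightarrow> i = q b" if "i < t" "b < t" for i b
  proof
    show "?w i = b \<Longrightarrow> i = q b" using bij_betw_inv_into_left[OF w, of i] that by (simp add: q_def)
    show "i = q b \<Longrightarrow> ?w i = b" using bij_betw_inv_into_right[OF w, of b] that by (simp add: q_def)
  qed
  \<comment> \<open>\<open>q b\<close> is the column with \<open>b\<close> in the last but one row,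
    and \<open>\<pi> b\<close> is the treatment that follows there. The identity outside the range
    is what \<open>permutes\<close> requires.\<close>
  define \<pi> where "\<pi> = (\<lambda>b. if b < t then ?v (q b) else b)"
  have "bij_betw (?v \<circ> q) {..<t} {..<t}" using q v by (rule bij_betw_trans)
  then have "bij_betw \<pi> {..<t} {..<t}" by (subst bij_betw_cong[where g = "?v \<circ> q"]) (auto simp: \<pi>_def)
  then have p: "\<pi> permutes {..<t}" by (rule bij_imp_permutes) (simp add: \<pi>_def)
  have lt: "\<pi> b < t" if "b < t" for b using permutes_in_image[OF p] that by simp
  have idx: "transition_mat t W $$ (a, b) = of_bool (a = \<pi> b)" if "a < t" "b < t" for a b
  proof -
    have qb: "q b < t" using q that by (auto dest: bij_betwE)
    have "transition_mat t W $$ (a, b) = (\<Sum>j<t. if j = q b then of_bool (?v j = a) else 0)"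
      unfolding transition_mat_index[OF that] using wq that by (intro sum.cong) auto
    then show ?thesis using qb that by (auto simp: \<pi>_def)
  qed
  have Pi: "transition_mat t W = mat t t (\<lambda>(a, b). if a = \<pi> b then 1 else 0)"
    using idx by (intro eq_matI) (auto simp: transition_mat_def treatment_mat_def)
  obtain f :: "nat \<Rightarrow> nat \<Rightarrow> complex" where
    f: "\<And>r a. a < t \<Longrightarrow> f r a = cis (2 * pi * of_nat r / of_nat t) * f r (\<pi> a)"
    and orth: "\<And>r r'. r < t \<Longrightarrow> r' < t \<Longrightarrow> (\<Sum>a<t. cnj (f r a) * f r' a) = (if r = r' then of_nat t else 0)"
    and f0: "\<And>a. f 0 a = 1"
    using single_orbit_eigenvectors[OF p t permutation_mat_single_orbit[OF p t Pi ev]] by blast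
  show ?thesis
  proof (rule that[OF orth f0])
    fix r x assume x: "x < t"
    \<comment> \<open>Row \<open>x\<close> of the matrix has its only nonzero entry at the preimage
      \<open>z\<close> of \<open>x\<close>; column \<open>x\<close> has it at
      \<open>\<pi> x\<close>.\<close>
    obtain z where z: "z < t" "x = \<pi> z"
      using x permutes_image[OF p] by (metis imageE lessThan_iff)
    have "(\<Sum>y<t. of_real (transition_mat t W $$ (x, y)) * f r y) = (\<Sum>y<t. if y = z then f r y else 0)"
      using x z permutes_inj[OF p] by (intro sum.cong) (auto simp: idx dest: injD)
    then show "(\<Sum>y<t. of_real (transition_mat t W $$ (x, y)) * f r y) = cis (2 * pi * r / t) * f r x"
      using z f[of z r] by simp
    have "(\<Sum>y<t. of_real (transition_mat t W $$ (y, x)) * f r y) = (\<Sum>y<t. if y = \<pi> x then f r y else 0)"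
      using x by (intro sum.cong) (auto simp: idx)
    also have "\<dots> = f r (\<pi> x)" using lt[OF x] by simp
    also have "\<dots> = cnj (cis (2 * pi * r / t)) * f r x"
      using f[OF x, of r] by (simp add: cis_cnj mult.assoc[symmetric] cis_mult)
    finally show "(\<Sum>y<t. of_real (transition_mat t W $$ (y, x)) * f r y) = cnj (cis (2 * pi * r / t)) * f r x" .
  qed
qed

section \<open>The eigenvalues for classes A and B\<close>

lemma UBRMD_square_once_in_last_two_rows:
  assumes W: "UBRMD t 1 W" and t: "2 \<le> t"
  shows "once_in_last_two_rows t W"
proof -
  have dim: "dim_col W = t" using W by (auto simp: UBRMD_def design_def)
  have "card {i \<in> {..<t}. W $$ (j, i) = a} = 1" if "j < t" "a < t" for j a
    using UBRMD_period[OF W t that] sum_of_bool_card[of "{..<t}" "\<lambda>i. W $$ (j, i) = a"] by simp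
  then show ?thesis using t by (auto simp: once_in_last_two_rows_def dim)
qed

lemma class_A_eigenvalues:
  assumes t: "4 \<le> t" and D: "class_A t g D"
    and G: "generalized_inverse (C22 t (first_periods (t - 1) D)) G"
  shows "has_eigenvalues (direct_info_mat t (first_periods (t - 1) D) G) (map (\<lambda>r. real g * theta_A t r) [0..<t])"
proof -
  obtain W where W: "W \<in> carrier_mat t t" and ub: "UBRMD t 1 W"
    and ev: "eigenvalue_multiplicity (transition_mat t W) 1 = 1" and asg: "assigns_subjects g W D" and g: "0 < g"
    using D by (auto simp: class_A_def)
  have gg: "g = g * 1" by simp
  interpret extended_design t g D by (rule UBRMD_extended_design(1)[OF ub asg t gg g])
  have lp: "last_pair a b = real g * transition_mat t W $$ (a, b)" if "a < t" "b < t" for a b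
    using UBRMD_extended_design(2)[OF ub asg t gg g, of a b] transition_mat_index[OF that, of W] by simp
  have once: "once_in_last_two_rows t W" using UBRMD_square_once_in_last_two_rows[OF ub] t by simp
  obtain f :: "nat \<Rightarrow> nat \<Rightarrow> complex" where
    f: "\<And>r r'. r < t \<Longrightarrow> r' < t \<Longrightarrow> (\<Sum>a<t. cnj (f r a) * f r' a) = (if r = r' then of_nat t else 0)"
      "\<And>a. f 0 a = 1"
    and T: "\<And>r x. x < t \<Longrightarrow> (\<Sum>y<t. of_real (transition_mat t W $$ (x, y)) * f r y) = cis (2 * pi * r / t) * f r x"
    and T': "\<And>r x. x < t \<Longrightarrow> (\<Sum>y<t. of_real (transition_mat t W $$ (y, x)) * f r y) = cnj (cis (2 * pi * r / t)) * f r x"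
    using transition_mat_eigenvectors[OF _ _ once ev] W t by auto
  show ?thesis
  \<comment> \<open>Here \<open>M\<close> is \<open>g\<close> times the permutation matrix, so
    \<open>\<mu>\<close> and \<open>\<nu>\<close> are conjugate roots of unity, and
    \<open>\<kappa>\<close> is the squared modulus of 1 plus such a root.\<close>
  proof (rule direct_info_eigenvalues[OF f _ _ _ _ _ _ _ _ G,
        where \<mu> = "\<lambda>r. cis (2 * pi * r / t)" and \<nu> = "\<lambda>r. cnj (cis (2 * pi * r / t))"
          and \<kappa> = "\<lambda>r. 2 * (1 + cos (2 * pi * r / t))"])
    fix r x assume x: "x < t"
    have "(\<Sum>y<t. of_real (last_pair x y) * f r y) = (\<Sum>y<t. of_nat g * (of_real (transition_mat t W $$ (x, y)) * f r y))"
      using x by (intro sum.cong) (auto simp: lp)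
    then show "(\<Sum>y<t. of_real (last_pair x y) * f r y) = of_nat g * cis (2 * pi * r / t) * f r x"
      by (simp add: T[OF x] flip: sum_distrib_left)
    have "(\<Sum>y<t. of_real (last_pair y x) * f r y) = (\<Sum>y<t. of_nat g * (of_real (transition_mat t W $$ (y, x)) * f r y))"
      using x by (intro sum.cong) (auto simp: lp)
    then show "(\<Sum>y<t. of_real (last_pair y x) * f r y) = of_nat g * cnj (cis (2 * pi * r / t)) * f r x"
      by (simp add: T'[OF x] flip: sum_distrib_left)
  next
    fix r
    show "cis (2 * pi * r / t) + cnj (cis (2 * pi * r / t)) = of_real (2 * cos (2 * pi * r / t))"
      by (simp add: complex_eq_iff)
    have "cos (2 * pi * r / t) * cos (2 * pi * r / t) + sin (2 * pi * r / t) * sin (2 * pi * r / t) = 1"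
      using sin_cos_squared_add2[of "2 * pi * r / t"] by (simp add: power2_eq_square)
    then show "(1 + cis (2 * pi * r / t)) * (1 + cnj (cis (2 * pi * r / t))) = of_real (2 * (1 + cos (2 * pi * r / t)))"
      by (simp add: complex_eq_iff algebra_simps)
  qed (simp_all add: theta_A_def)
qed

lemma class_B_eigenvalues:
  assumes t: "4 \<le> t" and D: "class_B t g D"
    and G: "generalized_inverse (C22 t (first_periods (t - 1) D)) G"
  shows "has_eigenvalues (direct_info_mat t (first_periods (t - 1) D) G) (map (\<lambda>r. real g * theta_B t r) [0..<t])"
proof -
  obtain W W' where W: "W \<in> carrier_mat t t" and W': "W' \<in> carrier_mat t t"
    and ub: "UBRMD t 2 (mat_of_cols t (cols W @ cols W'))" and once: "once_in_last_two_rows t W"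
    and ev: "eigenvalue_multiplicity (transition_mat t W) 1 = 1"
    and tr: "transition_mat t W' = transpose_mat (transition_mat t W)"
    and asg: "assigns_subjects (g div 2) (mat_of_cols t (cols W @ cols W')) D"
    and g: "0 < g" "even g"
    using D unfolding class_B_def by blast
  let ?V = "mat_of_cols t (cols W @ cols W')"
  have gg: "g = g div 2 * 2" using g by simp
  interpret extended_design t g D by (rule UBRMD_extended_design(1)[OF ub asg t gg g(1)])
  have V: "?V $$ (k, j) = W $$ (k, j)" "?V $$ (k, t + j) = W' $$ (k, j)" if "k < t" "j < t" for k j
    using W W' that by (simp_all add: mat_of_cols_index nth_append)
  \<comment> \<open>The first \<open>t\<close> columns of the combined array come from
    \<open>W\<close>, the others from \<open>W'\<close>.\<close>
  have split: "(\<Sum>j<2 * t. h j) = (\<Sum>j<t. h j) + (\<Sum>j<t. h (t + j))" for h :: "nat \<Rightarrow> real"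
  proof -
    have "(\<Sum>j<t + t. h j) = (\<Sum>j<t. h j) + (\<Sum>j = t..<t + t. h j)"
      by (simp add: sum.atLeastLessThan_concat flip: atLeast0LessThan)
    also have "(\<Sum>j = t..<t + t. h j) = (\<Sum>j<t. h (t + j))"
      using sum.shift_bounds_nat_ivl[of h 0 t t] by (simp add: atLeast0LessThan add.commute)
    finally show ?thesis by (simp add: mult_2)
  qed
  \<comment> \<open>The transition matrix of \<open>W'\<close> is the transpose of that of
    \<open>W\<close>, so \<open>M\<close> is symmetric and the Fourier basis obtained from
    \<open>W\<close> serves both squares.\<close>
  have lp: "last_pair a b = real g / 2 * (transition_mat t W $$ (a, b) + transition_mat t W $$ (b, a))"
    if "a < t" "b < t" for a b
  proof -
    have "last_pair a b = real (g div 2) * (transition_mat t W $$ (a, b) + transition_mat t W' $$ (a, b))"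
      unfolding UBRMD_extended_design(2)[OF ub asg t gg g(1), of a b] split
        transition_mat_index[OF that] using t by (simp add: V)
    moreover have "transition_mat t W' $$ (a, b) = transition_mat t W $$ (b, a)"
      unfolding tr using that by (simp add: transition_mat_def treatment_mat_def)
    moreover have "real (g div 2) = real g / 2" using \<open>even g\<close> by (auto elim: evenE)
    ultimately show ?thesis by simp
  qed
  obtain f :: "nat \<Rightarrow> nat \<Rightarrow> complex" where
    f: "\<And>r r'. r < t \<Longrightarrow> r' < t \<Longrightarrow> (\<Sum>a<t. cnj (f r a) * f r' a) = (if r = r' then of_nat t else 0)"
      "\<And>a. f 0 a = 1"
    and T: "\<And>r x. x < t \<Longrightarrow> (\<Sum>y<t. of_real (transition_mat t W $$ (x, y)) * f r y) = cis (2 * pi * r / t) * f r x"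
    and T': "\<And>r x. x < t \<Longrightarrow> (\<Sum>y<t. of_real (transition_mat t W $$ (y, x)) * f r y) = cnj (cis (2 * pi * r / t)) * f r x"
    using transition_mat_eigenvectors[OF _ _ once ev] W t by auto
  have M: "(\<Sum>y<t. of_real (last_pair x y) * f r y) = of_nat g * of_real (cos (2 * pi * r / t)) * f r x"
    if x: "x < t" for r x
  proof -
    have "(\<Sum>y<t. of_real (last_pair x y) * f r y)
      = (\<Sum>y<t. of_nat g / 2 * (of_real (transition_mat t W $$ (x, y)) * f r y)
          + of_nat g / 2 * (of_real (transition_mat t W $$ (y, x)) * f r y))"
      using x by (intro sum.cong) (auto simp: lp algebra_simps add_divide_distrib)
    also have "\<dots> = of_nat g / 2 * ((cis (2 * pi * r / t) + cnj (cis (2 * pi * r / t))) * f r x)"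
      by (simp only: sum.distrib T[OF x] T'[OF x] distrib_left distrib_right flip: sum_distrib_left)
    also have "cis (2 * pi * r / t) + cnj (cis (2 * pi * r / t)) = 2 * of_real (cos (2 * pi * r / t))"
      by (simp add: complex_eq_iff)
    finally show ?thesis by simp
  qed
  have sym: "last_pair y x = last_pair x y" if "x < t" "y < t" for x y
    unfolding lp[OF that] lp[OF that(2,1)] by (simp add: add.commute)
  show ?thesis
  \<comment> \<open>Averaging a root of unity with its conjugate leaves the cosine, so
    \<open>\<mu>\<close> and \<open>\<nu>\<close> coincide and \<open>\<kappa>\<close> is a
    square.\<close>
  proof (rule direct_info_eigenvalues[OF f _ _ _ _ _ _ _ _ G,
        where \<mu> = "\<lambda>r. of_real (cos (2 * pi * r / t))" and \<nu> = "\<lambda>r. of_real (cos (2 * pi * r / t))"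
          and \<kappa> = "\<lambda>r. (1 + cos (2 * pi * r / t))\<^sup>2"])
    fix r x assume x: "x < t"
    show "(\<Sum>y<t. of_real (last_pair x y) * f r y) = of_nat g * of_real (cos (2 * pi * r / t)) * f r x"
      by (rule M[OF x])
    have "(\<Sum>y<t. of_real (last_pair y x) * f r y) = (\<Sum>y<t. of_real (last_pair x y) * f r y)"
      using x by (intro sum.cong refl) (simp add: sym)
    then show "(\<Sum>y<t. of_real (last_pair y x) * f r y) = of_nat g * of_real (cos (2 * pi * r / t)) * f r x"
      using M[OF x] by simp
  qed (simp_all add: theta_B_def power2_eq_square)
qed

theorem theorem10:
  fixes t g :: nat and d_plan d_min :: "nat mat"
  assumes "4 \<le> t"
    and "d_min = first_periods (t - 1) d_plan"
  shows "(class_A t g d_plan \<longrightarrow>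
           (\<forall>G. generalized_inverse (C22 t d_min) G \<longrightarrow>
             has_eigenvalues (direct_info_mat t d_min G)
               (map (\<lambda>r. real g * theta_A t r) [0..<t]))) \<and>
         (class_B t g d_plan \<longrightarrow>
           (\<forall>G. generalized_inverse (C22 t d_min) G \<longrightarrow>
             has_eigenvalues (direct_info_mat t d_min G)
               (map (\<lambda>r. real g * theta_B t r) [0..<t])))"
  unfolding assms(2) using class_A_eigenvalues[OF assms(1)] class_B_eigenvalues[OF assms(1)] by blast

end
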